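(* Let $\eta\mapsto g_\eta$ be a slowly increasing symmetry group of the scalar partial differential equation $\Delta(x,u^{(n)})=0$, where $\Delta$ is slowly increasing. Set $N=\dim(\mathcal M^{(n)})$, let $z=(z_1,\dots,z_N)$ be the coordinates on $\mathcal M^{(n)}$ with $(z_1,\dots,z_p)=x$, and suppose that $\frac{\partial\Delta}{\partial z_k}\equiv c\neq0$ ($c$ a constant) for some $p+1\le k\le N$. Then $\eta\mapsto g_\eta$ is a symmetry group of $\Delta(x,u^{(n)})=0$ in $\mathcal G$.
   Context: Jet notation: $x\in\mathcal X=\mathbb R^p$ are the independent variables, $u\in\mathcal U=\mathbb R^q$ the dependent ones; the group acts as a smooth local one-parameter transformation group on an open set $\mathcal M\subseteq\mathcal X\times\mathcal U$; $\mathcal M^{(n)}$ is the $n$-jet space with coordinates $z=(x,u^{(n)})$, where $u^{(n)}$ collects $u$ and its partial derivatives up to order $n$; $\mathrm{pr}^{(n)}u(x)$ collects the values at $x$ of $u$ and its partial derivatives up to order $n$; $\mathrm{pr}^{(n)}g_\eta$ denotes the prolonged action on $\mathcal M^{(n)}$. $g_\eta u$ is the function whose graph is the image under $g_\eta$ of the graph of $u$. A (classical) symmetry group transforms smooth solutions into smooth solutions whenever the transformed function is defined; moreover it is understood that $\Delta(z)=0$ implies $\Delta(\mathrm{pr}^{(n)}g_\eta(z))=0$ for all $\eta$ and $z\in\mathcal M^{(n)}$ for which this is defined. Colombeau algebra: $I=(0,1]$, $\Omega\subseteq\mathbb R^p$ open. $\mathcal E_M(\Omega)$ is the set of $(u_\varepsilon)_{\varepsilon\in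 I}\in C^\infty(\Omega)^I$ such that for all compact $K\subset\Omega$ and all multi-indices $\alpha$ there is $m\in\mathbb N$ with $\sup_{x\in K}|\partial^\alpha u_\varepsilon(x)|=O(\varepsilon^{-m})$ as $\varepsilon\to0$; $\mathcal N(\Omega)$ is the set of those for which, for all $K,\alpha$ and all $m\in\mathbb N$, $\sup_{x\in K}|\partial^\alpha u_\varepsilon(x)|=O(\varepsilon^{m})$. $\mathcal G(\Omega)=\mathcal E_M(\Omega)/\mathcal N(\Omega)$; classes are written $\mathrm{cl}[(u_\varepsilon)_{\varepsilon\in I}]$. A smooth function is slowly increasing (in $\mathcal O_M$) if each of its partial derivatives is bounded by a constant times some power of $(1+|\cdot|)$. A projectable transformation $g$, $g\cdot(x,u)=(\Xi_g(x),\Phi_g(x,u))$, is slowly increasing if $u\mapsto\Phi_g(x,u)$ is slowly increasing, uniformly for $x$ in compact sets (for each compact set of $x$ and each partial derivative there is $m$ such that the derivative of $\Phi_g$ is bounded by $C(1+|u|)^m$ for $x$ in that set); slowly increasing group actions are always understood to be projectable. For such $g$ and $U=\mathrm{cl}[(u_\varepsilon)_\varepsilon]\in\mathcal G(\Omega)^q$, $gU:=\mathrm{cl}[((\Phi_g\circ(\mathrm{id}\times u_\varepsilon))\circ\Xi_g^{-1})_{\varepsilon\in I}]\in\mathcal G(\Xi_g(\Omega))^q$. A solution of the equation in $\mathcal G$ is $U\in\mathcal G(\Omega)^q$ ($\Omega\subseteq\mathcal X$ open) satisfying the equation with equality in $\mathcal G(\Omega)$. A local transformation group $G$ is a symmetry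 group of the equation in $\mathcal G$ if, whenever $U$ is a solution in $\mathcal G$, $g\in G$ and $gU$ is defined, $gU$ is also a solution in $\mathcal G$. *)

theory Defs
  imports "HOL-Analysis.Analysis" "HOL-Library.Type_Length"
begin

section \<open>Smooth functions and partial derivatives\<close>

text \<open>The sets \<open>S\<close> below are open, so that the Frechet derivative at a point of \<open>S\<close>, and everything
  built from it, depends only on the values of the function on \<open>S\<close>.\<close>

primrec Ck_on :: "nat \<Rightarrow> 'a::euclidean_space set \<Rightarrow> ('a \<Rightarrow> 'b::real_normed_vector) \<Rightarrow> bool" where
  "Ck_on 0 S f \<longleftrightarrow> continuous_on S f"
| "Ck_on (Suc k) S f \<longleftrightarrow> (\<forall>x\<in>S. f differentiable (at x)) \<and>
     (\<forall>v\<in>Basis. Ck_on k S (\<lambda>x. frechet_derivative f (at x) v))"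

definition smooth_on :: "'a::euclidean_space set \<Rightarrow> ('a \<Rightarrow> 'b::real_normed_vector) \<Rightarrow> bool" where
  "smooth_on S f \<longleftrightarrow> (\<forall>k. Ck_on k S f)"

text \<open>Iterated partial derivative along a list of (basis) vectors. For smooth functions the order of
  the list is irrelevant, so ``all partial derivatives'' means: all lists \<open>vs\<close> with
  \<open>set vs \<subseteq> Basis\<close>.\<close>

primrec partials :: "'a::real_normed_vector list \<Rightarrow> ('a \<Rightarrow> 'b::real_normed_vector) \<Rightarrow> 'a \<Rightarrow> 'b" where
  "partials [] f = f"
| "partials (v # vs) f = (\<lambda>x. frechet_derivative (partials vs f) (at x) v)"

text \<open>\<open>\<partial>\<^sup>\<alpha>\<close> for a multi-index \<open>\<alpha>\<close>: differentiate along any list of indices in which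
  each \<open>i\<close> occurs \<open>\<alpha> i\<close> times.\<close>

definition mderiv :: "('p::finite \<Rightarrow> nat) \<Rightarrow> (real^'p \<Rightarrow> 'b::real_normed_vector) \<Rightarrow> real^'p \<Rightarrow> 'b" where
  "mderiv \<alpha> f = partials (map (\<lambda>i. axis i 1) (SOME is. \<forall>i. count_list is i = \<alpha> i)) f"

definition slowly_increasing_on ::
    "'a::euclidean_space set \<Rightarrow> ('a \<Rightarrow> 'b::real_normed_vector) \<Rightarrow> bool" where
  "slowly_increasing_on S f \<longleftrightarrow> smooth_on S f \<and>
     (\<forall>vs. set vs \<subseteq> Basis \<longrightarrow>
        (\<exists>C m. \<forall>z\<in>S. norm (partials vs f z) \<le> C * (1 + norm z) ^ m))"


section \<open>Jet spaces\<close>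

text \<open>The order \<open>n\<close> of the jets is carried by a type: \<open>n = LENGTH('n)\<close>. Every natural number
  (including \<open>0\<close>) arises in this way.\<close>

typedef (overloaded) ('p::finite, 'n::len0) multi_index =
    "{\<alpha> :: 'p \<Rightarrow> nat. (\<Sum>i\<in>UNIV. \<alpha> i) \<le> LENGTH('n)}"
  by (rule exI[of _ "\<lambda>_. 0"]) simp

instance multi_index :: (finite, len0) finite
proof
  let ?A = "{\<alpha> :: 'a \<Rightarrow> nat. (\<Sum>i\<in>UNIV. \<alpha> i) \<le> LENGTH('b)}"
  have "\<alpha> i \<le> LENGTH('b)" if "\<alpha> \<in> ?A" for \<alpha> i
    using member_le_sum[of i UNIV \<alpha>] that by simp
  then have "?A \<subseteq> PiE UNIV (\<lambda>_. {..LENGTH('b)})"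
    by auto
  then have "finite ?A"
    by (rule finite_subset) (simp add: finite_PiE)
  moreover have "(UNIV :: ('a, 'b) multi_index set) = Abs_multi_index ` ?A"
    by (rule type_definition.Abs_image[OF type_definition_multi_index, symmetric])
  ultimately show "finite (UNIV :: ('a, 'b) multi_index set)"
    by (metis finite_imageI)
qed

definition zero_index :: "('p::finite, 'n::len0) multi_index" where
  "zero_index = Abs_multi_index (\<lambda>_. 0)"

text \<open>A jet \<open>z = (x, u\<^sup>(\<^sup>n\<^sup>))\<close>; the coordinate \<open>u\<^sub>\<alpha>\<^sup>a\<close> is \<open>snd z $ \<alpha> $ a\<close>.\<close>

type_synonym ('p, 'q, 'n) jet = "(real^'p) \<times> ((real^'q)^(('p, 'n) multi_index))"

definition jet :: "(real^'p \<Rightarrow> real^'q) \<Rightarrow> real^'p \<Rightarrow> ('p::finite, 'q::finite, 'n::len0) jet" where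
  "jet u x = (x, \<chi> \<alpha>. mderiv (Rep_multi_index \<alpha>) u x)"

definition jet_space :: "((real^'p) \<times> (real^'q)) set \<Rightarrow> ('p::finite, 'q::finite, 'n::len0) jet set" where
  "jet_space M = {z. (fst z, snd z $ zero_index) \<in> M}"

text \<open>The unit vector of the jet coordinate \<open>u\<^sub>\<alpha>\<^sup>a\<close>; these are the coordinates
  \<open>z\<^sub>k\<close> with \<open>k > p\<close>.\<close>

definition jet_unit ::
    "('p, 'n) multi_index \<Rightarrow> 'q \<Rightarrow> ('p::finite, 'q::finite, 'n::len0) jet" where
  "jet_unit \<alpha> a = (0, axis \<alpha> (axis a 1))"


section \<open>Local one-parameter transformation groups and their prolongations\<close>

text \<open>\<open>D\<close> is the domain of \<open>(\<eta>, m) \<mapsto> g \<eta> m\<close>, and \<open>at_param D \<eta>\<close> that of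
  \<open>g \<eta>\<close>.\<close>

definition at_param :: "(real \<times> 'a) set \<Rightarrow> real \<Rightarrow> 'a set" where
  "at_param D \<eta> = {m. (\<eta>, m) \<in> D}"

definition local_transformation_group ::
    "'a::euclidean_space set \<Rightarrow> (real \<times> 'a) set \<Rightarrow> (real \<Rightarrow> 'a \<Rightarrow> 'a) \<Rightarrow> bool" where
  "local_transformation_group M D g \<longleftrightarrow>
     open M \<and> open D \<and> D \<subseteq> UNIV \<times> M \<and> {0} \<times> M \<subseteq> D \<and>
     smooth_on D (\<lambda>(\<eta>, m). g \<eta> m) \<and>
     (\<forall>(\<eta>, m)\<in>D. g \<eta> m \<in> M) \<and>
     (\<forall>m\<in>M. g 0 m = m) \<and>
     (\<forall>\<eta> \<delta> m. (\<delta>, m) \<in> D \<longrightarrow> (\<eta>, g \<delta> m) \<in> D \<longrightarrow> (\<eta> + \<delta>, m) \<in> D \<longrightarrow>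
        g \<eta> (g \<delta> m) = g (\<eta> + \<delta>) m) \<and>
     (\<forall>(\<eta>, m)\<in>D. (- \<eta>, g \<eta> m) \<in> D)"

definition graph_on :: "'a set \<Rightarrow> ('a \<Rightarrow> 'b) \<Rightarrow> ('a \<times> 'b) set" where
  "graph_on S u = (\<lambda>x. (x, u x)) ` S"

text \<open>For a transformation \<open>h\<close> with domain \<open>E\<close>: the transform of \<open>u\<close> (on \<open>S\<close>) is defined and is
  the function \<open>v\<close> (on \<open>T\<close>).\<close>

definition transforms_to ::
    "((real^'p) \<times> (real^'q)) set \<Rightarrow> ((real^'p) \<times> (real^'q) \<Rightarrow> (real^'p) \<times> (real^'q)) \<Rightarrow>
     (real^'p) set \<Rightarrow> (real^'p \<Rightarrow> real^'q) \<Rightarrow> (real^'p) set \<Rightarrow> (real^'p \<Rightarrow> real^'q) \<Rightarrow> bool" where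
  "transforms_to E h S u T v \<longleftrightarrow>
     open S \<and> open T \<and> graph_on S u \<subseteq> E \<and> h ` graph_on S u = graph_on T v"

text \<open>\<open>prolongs_to E h z w\<close>: the prolonged action of \<open>h\<close> is defined at the jet \<open>z\<close> and has the
  value \<open>w\<close> there. By the chain rule \<open>w\<close> does not depend on the function \<open>u\<close> representing
  \<open>z\<close>.\<close>

definition prolongs_to ::
    "((real^'p) \<times> (real^'q)) set \<Rightarrow> ((real^'p) \<times> (real^'q) \<Rightarrow> (real^'p) \<times> (real^'q)) \<Rightarrow>
     ('p::finite, 'q::finite, 'n::len0) jet \<Rightarrow> ('p, 'q, 'n) jet \<Rightarrow> bool" where
  "prolongs_to E h z w \<longleftrightarrow>
     (\<exists>S u T v. transforms_to E h S u T v \<and> smooth_on S u \<and> smooth_on T v \<and>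
        (\<exists>x\<in>S. z = jet u x \<and> w = jet v (fst (h (x, u x)))))"


section \<open>Classical symmetry groups\<close>

definition smooth_solution ::
    "((real^'p) \<times> (real^'q)) set \<Rightarrow> (('p::finite, 'q::finite, 'n::len0) jet \<Rightarrow> real) \<Rightarrow>
     (real^'p) set \<Rightarrow> (real^'p \<Rightarrow> real^'q) \<Rightarrow> bool" where
  "smooth_solution M \<Delta> S u \<longleftrightarrow>
     open S \<and> smooth_on S u \<and> graph_on S u \<subseteq> M \<and> (\<forall>x\<in>S. \<Delta> (jet u x) = 0)"

definition symmetry_group ::
    "((real^'p) \<times> (real^'q)) set \<Rightarrow> (real \<times> ((real^'p) \<times> (real^'q))) set \<Rightarrow>
     (real \<Rightarrow> (real^'p) \<times> (real^'q) \<Rightarrow> (real^'p) \<times> (real^'q)) \<Rightarrow>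
     (('p::finite, 'q::finite, 'n::len0) jet \<Rightarrow> real) \<Rightarrow> bool" where
  "symmetry_group M D g \<Delta> \<longleftrightarrow>
     (\<forall>\<eta> S u T v. smooth_solution M \<Delta> S u \<longrightarrow> transforms_to (at_param D \<eta>) (g \<eta>) S u T v \<longrightarrow>
        smooth_solution M \<Delta> T v) \<and>
     (\<forall>\<eta>. \<forall>z\<in>jet_space M. \<forall>w. \<Delta> z = 0 \<longrightarrow> prolongs_to (at_param D \<eta>) (g \<eta>) z w \<longrightarrow> \<Delta> w = 0)"


section \<open>Projectable and slowly increasing group actions\<close>

definition projectable ::
    "((real^'p) \<times> (real^'q)) set \<Rightarrow> ((real^'p) \<times> (real^'q) \<Rightarrow> (real^'p) \<times> (real^'q)) \<Rightarrow> bool" where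
  "projectable E h \<longleftrightarrow> (\<exists>\<Xi>. \<forall>(x, u)\<in>E. fst (h (x, u)) = \<Xi> x)"

text \<open>\<open>E\<close> need not be a product; the estimates are required wherever \<open>h\<close> is defined. All partial
  derivatives of \<open>\<Phi> = snd \<circ> h\<close> occur, with respect to both \<open>x\<close> and \<open>u\<close>.\<close>

definition slowly_increasing_transformation ::
    "((real^'p) \<times> (real^'q)) set \<Rightarrow> ((real^'p) \<times> (real^'q) \<Rightarrow> (real^'p) \<times> (real^'q)) \<Rightarrow> bool" where
  "slowly_increasing_transformation E h \<longleftrightarrow> projectable E h \<and>
     (\<forall>K vs. compact K \<longrightarrow> K \<subseteq> fst ` E \<longrightarrow> set vs \<subseteq> Basis \<longrightarrow>
        (\<exists>C m. \<forall>(x, u)\<in>E. x \<in> K \<longrightarrow>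
           norm (partials vs (\<lambda>y. snd (h y)) (x, u)) \<le> C * (1 + norm u) ^ m))"

definition slowly_increasing_group ::
    "(real \<times> ((real^'p) \<times> (real^'q))) set \<Rightarrow>
     (real \<Rightarrow> (real^'p) \<times> (real^'q) \<Rightarrow> (real^'p) \<times> (real^'q)) \<Rightarrow> bool" where
  "slowly_increasing_group D g \<longleftrightarrow>
     (\<forall>\<eta>. slowly_increasing_transformation (at_param D \<eta>) (g \<eta>))"


section \<open>The Colombeau algebra\<close>

text \<open>A net \<open>u\<^sub>\<epsilon>\<close> is a function of \<open>\<epsilon>\<close>, of which only the values for \<open>0 < \<epsilon> \<le> 1\<close> matter.
  Likewise only the values of the \<open>u\<^sub>\<epsilon>\<close> on \<open>\<Omega>\<close> matter: nets that agree on \<open>\<Omega>\<close> differ by a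
  negligible net. For \<open>'b = real^'q\<close> the quotient is the \<open>q\<close>-fold power of the scalar algebra,
  moderateness and negligibility being componentwise properties.\<close>

type_synonym ('a, 'b) net = "real \<Rightarrow> 'a \<Rightarrow> 'b"

definition smooth_nets :: "'a::euclidean_space set \<Rightarrow> ('a, 'b::real_normed_vector) net set" where
  "smooth_nets \<Omega> = {u. \<forall>\<epsilon>\<in>{0<..1}. smooth_on \<Omega> (u \<epsilon>)}"

definition moderate :: "'a::euclidean_space set \<Rightarrow> ('a, 'b::real_normed_vector) net set" where
  "moderate \<Omega> = {u \<in> smooth_nets \<Omega>. \<forall>K vs. compact K \<longrightarrow> K \<subseteq> \<Omega> \<longrightarrow> set vs \<subseteq> Basis \<longrightarrow>
     (\<exists>m C. \<forall>\<^sub>F \<epsilon> in at_right 0. \<forall>x\<in>K. norm (partials vs (u \<epsilon>) x) \<le> C * inverse \<epsilon> ^ m)}"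

definition negligible_nets :: "'a::euclidean_space set \<Rightarrow> ('a, 'b::real_normed_vector) net set" where
  "negligible_nets \<Omega> = {u \<in> smooth_nets \<Omega>. \<forall>K vs m. compact K \<longrightarrow> K \<subseteq> \<Omega> \<longrightarrow> set vs \<subseteq> Basis \<longrightarrow>
     (\<exists>C. \<forall>\<^sub>F \<epsilon> in at_right 0. \<forall>x\<in>K. norm (partials vs (u \<epsilon>) x) \<le> C * \<epsilon> ^ m)}"

definition net_rel ::
    "'a::euclidean_space set \<Rightarrow> (('a, 'b::real_normed_vector) net \<times> ('a, 'b) net) set" where
  "net_rel \<Omega> = {(u, v). u \<in> moderate \<Omega> \<and> v \<in> moderate \<Omega> \<and>
     (\<lambda>\<epsilon> x. u \<epsilon> x - v \<epsilon> x) \<in> negligible_nets \<Omega>}"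

definition colombeau :: "'a::euclidean_space set \<Rightarrow> ('a, 'b::real_normed_vector) net set set" where
  "colombeau \<Omega> = moderate \<Omega> // net_rel \<Omega>"

text \<open>The class of a net that is not moderate is empty, hence not an element of \<open>colombeau \<Omega>\<close>.\<close>

definition cl :: "'a::euclidean_space set \<Rightarrow> ('a, 'b::real_normed_vector) net \<Rightarrow> ('a, 'b) net set" where
  "cl \<Omega> u = net_rel \<Omega> `` {u}"

definition rep :: "('a, 'b) net set \<Rightarrow> ('a, 'b) net" where
  "rep U = (SOME u. u \<in> U)"

text \<open>The left-hand side of the equation at a generalized function. For slowly increasing
  \<open>\<Delta>\<close> and \<open>\<Omega> \<times> UNIV \<subseteq> M\<close> it does not depend on the representative.\<close>

definition eval_in_colombeau ::
    "(('p::finite, 'q::finite, 'n::len0) jet \<Rightarrow> real) \<Rightarrow> (real^'p) set \<Rightarrow>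
     (real^'p, real^'q) net set \<Rightarrow> (real^'p, real) net set" where
  "eval_in_colombeau \<Delta> \<Omega> U = cl \<Omega> (\<lambda>\<epsilon> x. \<Delta> (jet (rep U \<epsilon>) x))"

text \<open>\<open>\<Omega> \<times> UNIV \<subseteq> M\<close> says that the jets of all functions on \<open>\<Omega>\<close> lie in the domain of the
  equation.\<close>

definition colombeau_solution ::
    "((real^'p) \<times> (real^'q)) set \<Rightarrow> (('p::finite, 'q::finite, 'n::len0) jet \<Rightarrow> real) \<Rightarrow>
     (real^'p) set \<Rightarrow> (real^'p, real^'q) net set \<Rightarrow> bool" where
  "colombeau_solution M \<Delta> \<Omega> U \<longleftrightarrow>
     open \<Omega> \<and> \<Omega> \<times> UNIV \<subseteq> M \<and> U \<in> colombeau \<Omega> \<and>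
     eval_in_colombeau \<Delta> \<Omega> U = cl \<Omega> (\<lambda>\<epsilon> x. 0)"

text \<open>The map \<open>\<Xi>\<close> of a projectable \<open>h\<close>. It is only used at points \<open>x\<close> for which \<open>h\<close> is defined on
  \<open>{x} \<times> UNIV\<close>, so that the argument \<open>0\<close> can be replaced by any other.\<close>

definition base_map :: "((real^'p) \<times> (real^'q) \<Rightarrow> (real^'p) \<times> (real^'q)) \<Rightarrow> real^'p \<Rightarrow> real^'p" where
  "base_map h x = fst (h (x, 0))"

definition act ::
    "((real^'p) \<times> (real^'q) \<Rightarrow> (real^'p) \<times> (real^'q)) \<Rightarrow> (real^'p) set \<Rightarrow>
     (real^'p \<Rightarrow> real^'q) \<Rightarrow> real^'p \<Rightarrow> real^'q" where
  "act h \<Omega> u = (\<lambda>x. snd (h (x, u x))) \<circ> inv_into \<Omega> (base_map h)"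

definition colombeau_act ::
    "((real^'p) \<times> (real^'q) \<Rightarrow> (real^'p) \<times> (real^'q)) \<Rightarrow> (real^'p) set \<Rightarrow>
     (real^'p, real^'q) net set \<Rightarrow> (real^'p, real^'q) net set" where
  "colombeau_act h \<Omega> U = cl (base_map h ` \<Omega>) (\<lambda>\<epsilon>. act h \<Omega> (rep U \<epsilon>))"

text \<open>\<open>\<Omega> \<times> UNIV \<subseteq> at_param D \<eta>\<close> says that the transform of \<open>U\<close> is defined.\<close>

definition colombeau_symmetry_group ::
    "((real^'p) \<times> (real^'q)) set \<Rightarrow> (real \<times> ((real^'p) \<times> (real^'q))) set \<Rightarrow>
     (real \<Rightarrow> (real^'p) \<times> (real^'q) \<Rightarrow> (real^'p) \<times> (real^'q)) \<Rightarrow>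
     (('p::finite, 'q::finite, 'n::len0) jet \<Rightarrow> real) \<Rightarrow> bool" where
  "colombeau_symmetry_group M D g \<Delta> \<longleftrightarrow>
     (\<forall>\<eta> \<Omega> U. colombeau_solution M \<Delta> \<Omega> U \<longrightarrow> \<Omega> \<times> UNIV \<subseteq> at_param D \<eta> \<longrightarrow>
        colombeau_solution M \<Delta> (base_map (g \<eta>) ` \<Omega>) (colombeau_act (g \<eta>) \<Omega> U))"

end

theory Submission
  imports Defs
begin

text \<open>Let the net \<open>u\<close> represent a solution, so that the residual \<open>\<Delta> (jet (u \<epsilon>) x)\<close> is negligible but in
  general not zero. The symmetry hypothesis speaks about exact zeros of \<open>\<Delta>\<close> only. The condition on
  the derivative bridges this gap: \<open>\<Delta>\<close> is affine with slope \<open>c\<close> in one jet coordinate, so the jet of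
  \<open>u \<epsilon>\<close> at a point \<open>x\<close> becomes a zero of \<open>\<Delta>\<close> once that coordinate is shifted by \<open>- \<Delta> (jet (u \<epsilon>) x) / c\<close>.
  The shift is realized by adding a function to \<open>u \<epsilon>\<close>: among the partial derivatives of \<open>(y - x)\<^sup>\<alpha> / \<alpha>!\<close>
  at \<open>x\<close> only the one with index \<open>\<alpha>\<close> does not vanish (lemma \<open>jet_add_correction\<close>).

  The correction works at one point for each \<open>\<epsilon>\<close>, and one point is enough. Given a compact set \<open>K\<close>,
  let \<open>p \<epsilon>\<close> be a point of \<open>K\<close> at which the residual of the transformed net is largest, and correct
  \<open>u \<epsilon>\<close> at the preimage of \<open>p \<epsilon>\<close>. The corrected net \<open>w\<close> differs from \<open>u\<close> by a negligible net, hence so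
  do the transforms of \<open>w\<close> and \<open>u\<close> and the residuals of these transforms. At \<open>p \<epsilon>\<close> the transform of
  \<open>w \<epsilon>\<close> has residual zero by the symmetry hypothesis. So the maximum over \<open>K\<close> of the residual of the
  transform of \<open>u \<epsilon>\<close> is negligible (lemma \<open>negligible_equation_act\<close>). Growth of the prolonged action on
  jets never has to be estimated: the argument uses only that transforming a net and inserting it
  into \<open>\<Delta>\<close> are well defined on classes.

  This well-definedness rests on three facts. Moderate nets are stable under composition, by
  induction on the order of differentiation (\<open>moderate_order_compose\<close>). Differences of compositions
  are small by the mean value theorem, where polynomial growth makes the Lipschitz constants moderate
  (\<open>locally_negligible_tempered_diff\<close>). Finally a moderate net is negligible as soon as its values
  are, because derivatives can be interpolated between the values and the next higher derivatives
  (\<open>negligible_iff_locally_negligible\<close>); estimates of derivatives of differences are thereby avoided.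

  It remains to see that the transform of \<open>U\<close> again lives over a region all of whose fibres lie in
  the domain of the equation. The inverse transformation belongs to the group and is slowly
  increasing as well, so it is bounded on bounded parts of a fibre; this makes the action on each fibre
  proper and therefore onto (\<open>full_fibre\<close>).\<close>

section \<open>Iterated partial derivatives\<close>

lemma partials_append: "partials (vs @ ws) f = partials vs (partials ws f)"
  by (induction vs) auto

text \<open>The recursion of \<^const>\<open>partials\<close> splits off the outermost derivative, that of \<^const>\<open>Ck_on\<close> the
  innermost one. This equation translates between the two.\<close>

lemma partials_snoc:
  "partials (vs @ [v]) f = partials vs (\<lambda>x. frechet_derivative f (at x) v)"
  by (simp add: partials_append)

lemma has_derivative_cong_open:
  assumes "open S" "x \<in> S" "\<And>y. y \<in> S \<Longrightarrow> f y = g y"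
  shows "(f has_derivative f') (at x) \<longleftrightarrow> (g has_derivative f') (at x)"
proof
  show "(f has_derivative f') (at x) \<Longrightarrow> (g has_derivative f') (at x)"
    by (erule has_derivative_transform_within_open[OF _ assms(1,2)]) (rule assms(3))
  show "(g has_derivative f') (at x) \<Longrightarrow> (f has_derivative f') (at x)"
    by (erule has_derivative_transform_within_open[OF _ assms(1,2)]) (rule assms(3)[symmetric])
qed

lemma frechet_derivative_cong_open:
  assumes "open S" "x \<in> S" "\<And>y. y \<in> S \<Longrightarrow> f y = g y"
  shows "frechet_derivative f (at x) = frechet_derivative g (at x)"
proof -
  have "(f has_derivative f') (at x) \<longleftrightarrow> (g has_derivative f') (at x)" for f'
    by (rule has_derivative_cong_open[OF assms])
  then show ?thesis by (simp add: frechet_derivative_def)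
qed

lemma differentiable_cong_open:
  assumes "open S" "x \<in> S" "\<And>y. y \<in> S \<Longrightarrow> f y = g y"
  shows "f differentiable (at x) \<longleftrightarrow> g differentiable (at x)"
  unfolding differentiable_def using has_derivative_cong_open[OF assms] by simp

lemma frechet_derivative_eqI:
  "(f has_derivative f') (at x) \<Longrightarrow> frechet_derivative f (at x) = f'"
  using frechet_derivative_at by metis

text \<open>Reduces the chain rule to derivatives along basis vectors, the only ones that the definitions of
  smoothness and moderateness control.\<close>

lemma frechet_derivative_basis_expansion:
  fixes f :: "'a::euclidean_space \<Rightarrow> 'b::real_normed_vector"
  assumes "f differentiable (at x)"
  shows "frechet_derivative f (at x) v
    = (\<Sum>b\<in>Basis. (v \<bullet> b) *\<^sub>R frechet_derivative f (at x) b)"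
proof -
  have "linear (frechet_derivative f (at x))"
    using assms linear_frechet_derivative by blast
  then have "frechet_derivative f (at x) (\<Sum>b\<in>Basis. (v \<bullet> b) *\<^sub>R b)
    = (\<Sum>b\<in>Basis. (v \<bullet> b) *\<^sub>R frechet_derivative f (at x) b)"
    by (simp add: linear_sum linear_scale)
  then show ?thesis by (simp add: euclidean_representation)
qed

lemma smooth_on_partial:
  assumes "smooth_on S f" "v \<in> Basis"
  shows "smooth_on S (\<lambda>x. frechet_derivative f (at x) v)"
  using assms unfolding smooth_on_def by (metis Ck_on.simps(2))

lemma smooth_on_partials:
  assumes "smooth_on S f" "set vs \<subseteq> Basis"
  shows "smooth_on S (partials vs f)"
  using assms(2) by (induction vs) (auto intro: smooth_on_partial assms(1))

lemma smooth_on_differentiable: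
  assumes "smooth_on S f" "x \<in> S"
  shows "f differentiable (at x)"
  using assms unfolding smooth_on_def by (metis Ck_on.simps(2))

lemma smooth_on_continuous: "smooth_on S f \<Longrightarrow> continuous_on S f"
  unfolding smooth_on_def by (metis Ck_on.simps(1))

lemma smooth_on_subset: "smooth_on S f \<Longrightarrow> T \<subseteq> S \<Longrightarrow> smooth_on T f"
proof -
  have "Ck_on k S f \<Longrightarrow> T \<subseteq> S \<Longrightarrow> Ck_on k T f" for k
    by (induction k arbitrary: f) (auto intro: continuous_on_subset)
  then show "smooth_on S f \<Longrightarrow> T \<subseteq> S \<Longrightarrow> smooth_on T f"
    by (auto simp: smooth_on_def)
qed

section \<open>Orders of growth in the parameter\<close>

text \<open>The estimates on a single set, separated from smoothness, so that they also make sense for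
  auxiliary nets such as norms and Lipschitz constants.\<close>

definition moderate_bound :: "'a set \<Rightarrow> ('a, 'b::real_normed_vector) net \<Rightarrow> bool" where
  "moderate_bound K f \<longleftrightarrow>
     (\<exists>m C. \<forall>\<^sub>F \<epsilon> in at_right 0. \<forall>x\<in>K. norm (f \<epsilon> x) \<le> C * inverse \<epsilon> ^ m)"

definition negligible_bound :: "'a set \<Rightarrow> ('a, 'b::real_normed_vector) net \<Rightarrow> bool" where
  "negligible_bound K f \<longleftrightarrow>
     (\<forall>m. \<exists>C. \<forall>\<^sub>F \<epsilon> in at_right 0. \<forall>x\<in>K. norm (f \<epsilon> x) \<le> C * \<epsilon> ^ m)"

lemma eventually_unit_interval: "\<forall>\<^sub>F \<epsilon>::real in at_right 0. \<epsilon> \<in> {0<..1}"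
  using eventually_at_right_real[OF zero_less_one] by eventually_elim auto

lemma moderate_bound_dominated:
  assumes "moderate_bound K g"
    and "\<And>\<epsilon> x. \<epsilon> \<in> {0<..1} \<Longrightarrow> x \<in> K \<Longrightarrow> norm (f \<epsilon> x) \<le> norm (g \<epsilon> x)"
  shows "moderate_bound K f"
proof -
  obtain m C where "\<forall>\<^sub>F \<epsilon> in at_right 0. \<forall>x\<in>K. norm (g \<epsilon> x) \<le> C * inverse \<epsilon> ^ m"
    using assms(1) unfolding moderate_bound_def by blast
  with eventually_unit_interval
  have "\<forall>\<^sub>F \<epsilon> in at_right 0. \<forall>x\<in>K. norm (f \<epsilon> x) \<le> C * inverse \<epsilon> ^ m"
    by eventually_elim (use assms(2) order_trans in blast)
  then show ?thesis unfolding moderate_bound_def by blast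
qed

lemma negligible_bound_dominated:
  assumes "negligible_bound K g"
    and "\<And>\<epsilon> x. \<epsilon> \<in> {0<..1} \<Longrightarrow> x \<in> K \<Longrightarrow> norm (f \<epsilon> x) \<le> norm (g \<epsilon> x)"
  shows "negligible_bound K f"
  unfolding negligible_bound_def
proof
  fix m
  obtain C where "\<forall>\<^sub>F \<epsilon> in at_right 0. \<forall>x\<in>K. norm (g \<epsilon> x) \<le> C * \<epsilon> ^ m"
    using assms(1) unfolding negligible_bound_def by blast
  with eventually_unit_interval
  have "\<forall>\<^sub>F \<epsilon> in at_right 0. \<forall>x\<in>K. norm (f \<epsilon> x) \<le> C * \<epsilon> ^ m"
    by eventually_elim (use assms(2) order_trans in blast)
  then show "\<exists>C. \<forall>\<^sub>F \<epsilon> in at_right 0. \<forall>x\<in>K. norm (f \<epsilon> x) \<le> C * \<epsilon> ^ m" by blast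
qed

lemma moderate_boundE:
  assumes "moderate_bound K f"
  obtains m C where "C \<ge> 0"
    "\<forall>\<^sub>F \<epsilon> in at_right 0. \<forall>x\<in>K. norm (f \<epsilon> x) \<le> C * inverse \<epsilon> ^ m"
proof -
  obtain m C where *: "\<forall>\<^sub>F \<epsilon> in at_right 0. \<forall>x\<in>K. norm (f \<epsilon> x) \<le> C * inverse \<epsilon> ^ m"
    using assms(1) unfolding moderate_bound_def by blast
  from * eventually_unit_interval
  have "\<forall>\<^sub>F \<epsilon> in at_right 0. \<forall>x\<in>K. norm (f \<epsilon> x) \<le> \<bar>C\<bar> * inverse \<epsilon> ^ m"
  proof eventually_elim
    case (elim \<epsilon>)
    have "C * inverse \<epsilon> ^ m \<le> \<bar>C\<bar> * inverse \<epsilon> ^ m"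
      using elim(2) by (intro mult_right_mono) auto
    then show ?case using elim(1) by force
  qed
  then show ?thesis using that[of "\<bar>C\<bar>" m] by simp
qed

lemma negligible_boundE:
  assumes "negligible_bound K f"
  obtains C where "C \<ge> 0"
    "\<forall>\<^sub>F \<epsilon> in at_right 0. \<forall>x\<in>K. norm (f \<epsilon> x) \<le> C * \<epsilon> ^ m"
proof -
  obtain C where *: "\<forall>\<^sub>F \<epsilon> in at_right 0. \<forall>x\<in>K. norm (f \<epsilon> x) \<le> C * \<epsilon> ^ m"
    using assms(1) unfolding negligible_bound_def by blast
  from * eventually_unit_interval
  have "\<forall>\<^sub>F \<epsilon> in at_right 0. \<forall>x\<in>K. norm (f \<epsilon> x) \<le> \<bar>C\<bar> * \<epsilon> ^ m"
  proof eventually_elim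
    case (elim \<epsilon>)
    have "C * \<epsilon> ^ m \<le> \<bar>C\<bar> * \<epsilon> ^ m"
      using elim(2) by (intro mult_right_mono) auto
    then show ?case using elim(1) by force
  qed
  then show ?thesis using that[of "\<bar>C\<bar>"] by simp
qed

lemma moderate_bound_const: "moderate_bound K (\<lambda>\<epsilon> x. c)"
  unfolding moderate_bound_def
  by (rule exI[of _ 0], rule exI[of _ "norm c"]) simp

lemma moderate_bound_bounded:
  assumes "\<And>\<epsilon> x. \<epsilon> \<in> {0<..1} \<Longrightarrow> x \<in> K \<Longrightarrow> norm (f \<epsilon> x) \<le> B"
  shows "moderate_bound K f"
  by (rule moderate_bound_dominated[OF moderate_bound_const[of _ B]]) (use assms in force)

lemma moderate_bound_norm_iff: "moderate_bound K (\<lambda>\<epsilon> x. norm (f \<epsilon> x)) \<longleftrightarrow> moderate_bound K f"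
  by (simp add: moderate_bound_def)

lemma moderate_bound_add:
  assumes "moderate_bound K f" "moderate_bound K g"
  shows "moderate_bound K (\<lambda>\<epsilon> x. f \<epsilon> x + g \<epsilon> x)"
proof -
  obtain m C where 1: "C \<ge> 0" "\<forall>\<^sub>F \<epsilon> in at_right 0. \<forall>x\<in>K. norm (f \<epsilon> x) \<le> C * inverse \<epsilon> ^ m"
    using assms(1) by (rule moderate_boundE)
  obtain m' C' where 2: "C' \<ge> 0" "\<forall>\<^sub>F \<epsilon> in at_right 0. \<forall>x\<in>K. norm (g \<epsilon> x) \<le> C' * inverse \<epsilon> ^ m'"
    using assms(2) by (rule moderate_boundE)
  from 1(2) 2(2) eventually_unit_interval
  have "\<forall>\<^sub>F \<epsilon> in at_right 0. \<forall>x\<in>K. norm (f \<epsilon> x + g \<epsilon> x) \<le> (C + C') * inverse \<epsilon> ^ (m + m')"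
  proof eventually_elim
    case (elim \<epsilon>)
    have "inverse \<epsilon> \<ge> 1" using elim(3) by (simp add: one_le_inverse_iff)
    then have "C * inverse \<epsilon> ^ m \<le> C * inverse \<epsilon> ^ (m + m')"
        "C' * inverse \<epsilon> ^ m' \<le> C' * inverse \<epsilon> ^ (m + m')"
      using 1 2 by (auto intro!: mult_left_mono power_increasing)
    then show ?case using elim(1,2)
      by (smt (verit, best) distrib_right norm_triangle_ineq)
  qed
  then show ?thesis unfolding moderate_bound_def by blast
qed

lemma moderate_bound_sum:
  fixes f :: "'i \<Rightarrow> ('a, 'b::real_normed_vector) net"
  assumes "finite A" "\<And>i. i \<in> A \<Longrightarrow> moderate_bound K (f i)"
  shows "moderate_bound K (\<lambda>\<epsilon> x. \<Sum>i\<in>A. f i \<epsilon> x)"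
  using assms
proof (induction A)
  case empty
  show ?case using moderate_bound_const[of K 0] by simp
next
  case (insert i A)
  have "moderate_bound K (\<lambda>\<epsilon> x. f i \<epsilon> x + (\<Sum>i\<in>A. f i \<epsilon> x))"
    by (rule moderate_bound_add) (use insert in auto)
  then show ?case using insert.hyps by simp
qed

lemma moderate_bound_mult:
  fixes f g :: "('a, real) net"
  assumes "moderate_bound K f" "moderate_bound K g"
  shows "moderate_bound K (\<lambda>\<epsilon> x. f \<epsilon> x * g \<epsilon> x)"
proof -
  obtain m C where 1: "C \<ge> 0" "\<forall>\<^sub>F \<epsilon> in at_right 0. \<forall>x\<in>K. norm (f \<epsilon> x) \<le> C * inverse \<epsilon> ^ m"
    using assms(1) by (rule moderate_boundE)
  obtain m' C' where 2: "C' \<ge> 0" "\<forall>\<^sub>F \<epsilon> in at_right 0. \<forall>x\<in>K. norm (g \<epsilon> x) \<le> C' * inverse \<epsilon> ^ m'"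
    using assms(2) by (rule moderate_boundE)
  from 1(2) 2(2) eventually_unit_interval
  have "\<forall>\<^sub>F \<epsilon> in at_right 0. \<forall>x\<in>K. norm (f \<epsilon> x * g \<epsilon> x) \<le> (C * C') * inverse \<epsilon> ^ (m + m')"
  proof eventually_elim
    case (elim \<epsilon>)
    show ?case
    proof
      fix x assume "x \<in> K"
      then have "norm (f \<epsilon> x) * norm (g \<epsilon> x) \<le> (C * inverse \<epsilon> ^ m) * (C' * inverse \<epsilon> ^ m')"
        using elim 1 by (intro mult_mono) auto
      then show "norm (f \<epsilon> x * g \<epsilon> x) \<le> (C * C') * inverse \<epsilon> ^ (m + m')"
        by (simp add: abs_mult power_add mult_ac)
    qed
  qed
  then show ?thesis unfolding moderate_bound_def by blast
qed

lemma moderate_bound_power: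
  fixes f :: "('a, real) net"
  shows "moderate_bound K f \<Longrightarrow> moderate_bound K (\<lambda>\<epsilon> x. f \<epsilon> x ^ m)"
  by (induction m) (auto intro: moderate_bound_const moderate_bound_mult)

lemma moderate_bound_one_plus_power:
  fixes f :: "('a, real) net"
  assumes "moderate_bound K f"
  shows "moderate_bound K (\<lambda>\<epsilon> x. C * (1 + f \<epsilon> x) ^ m)"
  by (rule moderate_bound_mult[OF moderate_bound_const
        moderate_bound_power[OF moderate_bound_add[OF moderate_bound_const assms]]])

lemma moderate_bound_bilinear:
  assumes "bounded_bilinear B" "moderate_bound K f" "moderate_bound K g"
  shows "moderate_bound K (\<lambda>\<epsilon> x. B (f \<epsilon> x) (g \<epsilon> x))"
proof -
  interpret bounded_bilinear B by fact
  obtain C where C: "\<And>a b. norm (B a b) \<le> norm a * norm b * C"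
    using bounded by blast
  have "moderate_bound K (\<lambda>\<epsilon> x. norm (f \<epsilon> x) * norm (g \<epsilon> x) * C)"
    using assms(2,3) by (intro moderate_bound_mult moderate_bound_const) (simp_all add: moderate_bound_norm_iff)
  then show ?thesis
    by (rule moderate_bound_dominated)
      (unfold real_norm_def, rule order_trans[OF C abs_ge_self])
qed

lemma moderate_bound_linear:
  assumes "bounded_linear L" "moderate_bound K f"
  shows "moderate_bound K (\<lambda>\<epsilon> x. L (f \<epsilon> x))"
proof -
  obtain C where C: "\<And>a. norm (L a) \<le> norm a * C"
    using assms(1) bounded_linear.bounded by blast
  have "moderate_bound K (\<lambda>\<epsilon> x. norm (f \<epsilon> x) * C)"
    using assms(2) by (intro moderate_bound_mult moderate_bound_const) (simp_all add: moderate_bound_norm_iff)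
  then show ?thesis
    by (rule moderate_bound_dominated)
      (unfold real_norm_def, rule order_trans[OF C abs_ge_self])
qed

lemma negligible_bound_add:
  assumes "negligible_bound K f" "negligible_bound K g"
  shows "negligible_bound K (\<lambda>\<epsilon> x. f \<epsilon> x + g \<epsilon> x)"
  unfolding negligible_bound_def
proof
  fix m
  obtain C where 1: "C \<ge> 0" "\<forall>\<^sub>F \<epsilon> in at_right 0. \<forall>x\<in>K. norm (f \<epsilon> x) \<le> C * \<epsilon> ^ m"
    using assms(1) by (rule negligible_boundE)
  obtain C' where 2: "C' \<ge> 0" "\<forall>\<^sub>F \<epsilon> in at_right 0. \<forall>x\<in>K. norm (g \<epsilon> x) \<le> C' * \<epsilon> ^ m"
    using assms(2) by (rule negligible_boundE)
  from 1(2) 2(2)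
  have "\<forall>\<^sub>F \<epsilon> in at_right 0. \<forall>x\<in>K. norm (f \<epsilon> x + g \<epsilon> x) \<le> (C + C') * \<epsilon> ^ m"
    by eventually_elim (smt (verit, best) distrib_right norm_triangle_ineq)
  then show "\<exists>C. \<forall>\<^sub>F \<epsilon> in at_right 0. \<forall>x\<in>K. norm (f \<epsilon> x + g \<epsilon> x) \<le> C * \<epsilon> ^ m" by blast
qed

text \<open>Growth of order \<open>\<epsilon>\<^sup>-\<^sup>m\<close> of the first factor is absorbed by asking for order \<open>m + k\<close> of the second.\<close>

lemma negligible_bound_mult:
  fixes f g :: "('a, real) net"
  assumes "moderate_bound K f" "negligible_bound K g"
  shows "negligible_bound K (\<lambda>\<epsilon> x. f \<epsilon> x * g \<epsilon> x)"
  unfolding negligible_bound_def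
proof
  fix k
  obtain m C where 1: "C \<ge> 0" "\<forall>\<^sub>F \<epsilon> in at_right 0. \<forall>x\<in>K. norm (f \<epsilon> x) \<le> C * inverse \<epsilon> ^ m"
    using assms(1) by (rule moderate_boundE)
  obtain C' where 2: "C' \<ge> 0" "\<forall>\<^sub>F \<epsilon> in at_right 0. \<forall>x\<in>K. norm (g \<epsilon> x) \<le> C' * \<epsilon> ^ (m + k)"
    using assms(2) by (rule negligible_boundE)
  from 1(2) 2(2) eventually_unit_interval
  have "\<forall>\<^sub>F \<epsilon> in at_right 0. \<forall>x\<in>K. norm (f \<epsilon> x * g \<epsilon> x) \<le> (C * C') * \<epsilon> ^ k"
  proof eventually_elim
    case (elim \<epsilon>)
    show ?case
    proof
      fix x assume "x \<in> K"
      then have "norm (f \<epsilon> x) * norm (g \<epsilon> x) \<le> (C * inverse \<epsilon> ^ m) * (C' * \<epsilon> ^ (m + k))"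
        using elim 1 by (intro mult_mono) auto
      also have "\<dots> = (C * C') * \<epsilon> ^ k"
        using elim(3) by (simp add: power_add power_inverse field_simps)
      finally show "norm (f \<epsilon> x * g \<epsilon> x) \<le> (C * C') * \<epsilon> ^ k"
        by (simp add: abs_mult)
    qed
  qed
  then show "\<exists>C. \<forall>\<^sub>F \<epsilon> in at_right 0. \<forall>x\<in>K. norm (f \<epsilon> x * g \<epsilon> x) \<le> C * \<epsilon> ^ k" by blast
qed

lemma negligible_bound_norm_iff: "negligible_bound K (\<lambda>\<epsilon> x. norm (f \<epsilon> x)) \<longleftrightarrow> negligible_bound K f"
  by (simp add: negligible_bound_def)

lemma negligible_imp_moderate_bound:
  assumes "negligible_bound K f"
  shows "moderate_bound K f"
proof -
  obtain C where "\<forall>\<^sub>F \<epsilon> in at_right 0. \<forall>x\<in>K. norm (f \<epsilon> x) \<le> C * \<epsilon> ^ 0"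
    using assms unfolding negligible_bound_def by blast
  then have "\<forall>\<^sub>F \<epsilon> in at_right 0. \<forall>x\<in>K. norm (f \<epsilon> x) \<le> C * inverse \<epsilon> ^ 0"
    by simp
  then show ?thesis unfolding moderate_bound_def by blast
qed

lemma moderate_bound_subset:
  assumes "moderate_bound L f" "K \<subseteq> L"
  shows "moderate_bound K f"
proof -
  obtain m C where "\<forall>\<^sub>F \<epsilon> in at_right 0. \<forall>x\<in>L. norm (f \<epsilon> x) \<le> C * inverse \<epsilon> ^ m"
    using assms(1) unfolding moderate_bound_def by blast
  then have "\<forall>\<^sub>F \<epsilon> in at_right 0. \<forall>x\<in>K. norm (f \<epsilon> x) \<le> C * inverse \<epsilon> ^ m"
    by eventually_elim (use assms(2) in blast)
  then show ?thesis unfolding moderate_bound_def by blast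
qed

lemma negligible_bound_subset:
  assumes "negligible_bound L f" "K \<subseteq> L"
  shows "negligible_bound K f"
  unfolding negligible_bound_def
proof
  fix m
  obtain C where "\<forall>\<^sub>F \<epsilon> in at_right 0. \<forall>x\<in>L. norm (f \<epsilon> x) \<le> C * \<epsilon> ^ m"
    using assms(1) unfolding negligible_bound_def by blast
  then have "\<forall>\<^sub>F \<epsilon> in at_right 0. \<forall>x\<in>K. norm (f \<epsilon> x) \<le> C * \<epsilon> ^ m"
    by eventually_elim (use assms(2) in blast)
  then show "\<exists>C. \<forall>\<^sub>F \<epsilon> in at_right 0. \<forall>x\<in>K. norm (f \<epsilon> x) \<le> C * \<epsilon> ^ m" by blast
qed

text \<open>The values at points that move with \<open>\<epsilon>\<close> inside \<open>K\<close> are read as constant functions on any set \<open>L\<close>;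
  in this form they can serve as coefficients of nets.\<close>

lemma negligible_bound_at_points:
  assumes "negligible_bound K f" "\<And>\<epsilon>. \<epsilon> \<in> {0<..1} \<Longrightarrow> p \<epsilon> \<in> K"
  shows "negligible_bound L (\<lambda>\<epsilon> y. f \<epsilon> (p \<epsilon>))"
  unfolding negligible_bound_def
proof
  fix m
  obtain C where "\<forall>\<^sub>F \<epsilon> in at_right 0. \<forall>x\<in>K. norm (f \<epsilon> x) \<le> C * \<epsilon> ^ m"
    using assms(1) unfolding negligible_bound_def by blast
  with eventually_unit_interval
  have "\<forall>\<^sub>F \<epsilon> in at_right 0. \<forall>y\<in>L. norm (f \<epsilon> (p \<epsilon>)) \<le> C * \<epsilon> ^ m"
    by eventually_elim (use assms(2) in blast)
  then show "\<exists>C. \<forall>\<^sub>F \<epsilon> in at_right 0. \<forall>y\<in>L. norm (f \<epsilon> (p \<epsilon>)) \<le> C * \<epsilon> ^ m" by blast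
qed

lemma moderate_bound_compose_image:
  "moderate_bound (\<psi> ` K) f \<Longrightarrow> moderate_bound K (\<lambda>\<epsilon> x. f \<epsilon> (\<psi> x))"
  by (simp add: moderate_bound_def)

lemma negligible_bound_compose_image:
  "negligible_bound (\<psi> ` K) f \<Longrightarrow> negligible_bound K (\<lambda>\<epsilon> x. f \<epsilon> (\<psi> x))"
  by (simp add: negligible_bound_def)

section \<open>Moderate nets\<close>

definition locally_moderate :: "'a::topological_space set \<Rightarrow> ('a, 'b::real_normed_vector) net \<Rightarrow> bool" where
  "locally_moderate \<Omega> f \<longleftrightarrow> (\<forall>K. compact K \<longrightarrow> K \<subseteq> \<Omega> \<longrightarrow> moderate_bound K f)"

definition locally_negligible :: "'a::topological_space set \<Rightarrow> ('a, 'b::real_normed_vector) net \<Rightarrow> bool" where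
  "locally_negligible \<Omega> f \<longleftrightarrow> (\<forall>K. compact K \<longrightarrow> K \<subseteq> \<Omega> \<longrightarrow> negligible_bound K f)"

text \<open>Moderateness up to order \<open>k\<close>, with the recursion of \<^const>\<open>Ck_on\<close>: products and compositions can then
  be treated by induction on \<open>k\<close> with the Leibniz and the chain rule. Differentiability is included
  in order that one induction gives smoothness and estimates at the same time; applied to nets that do
  not depend on \<open>\<epsilon>\<close>, it also gives the corresponding facts about smooth functions.\<close>

primrec moderate_order ::
    "nat \<Rightarrow> 'a::euclidean_space set \<Rightarrow> ('a, 'b::real_normed_vector) net \<Rightarrow> bool" where
  "moderate_order 0 \<Omega> f \<longleftrightarrow> locally_moderate \<Omega> f \<and> (\<forall>\<epsilon>\<in>{0<..1}. continuous_on \<Omega> (f \<epsilon>))"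
| "moderate_order (Suc k) \<Omega> f \<longleftrightarrow> locally_moderate \<Omega> f \<and>
     (\<forall>\<epsilon>\<in>{0<..1}. \<forall>x\<in>\<Omega>. f \<epsilon> differentiable (at x)) \<and>
     (\<forall>v\<in>Basis. moderate_order k \<Omega> (\<lambda>\<epsilon> x. frechet_derivative (f \<epsilon>) (at x) v))"

lemma moderate_order_locally_moderate: "moderate_order k \<Omega> f \<Longrightarrow> locally_moderate \<Omega> f"
  by (cases k) auto

lemma moderate_iff_locally_moderate:
  "f \<in> moderate \<Omega> \<longleftrightarrow> f \<in> smooth_nets \<Omega> \<and>
     (\<forall>vs. set vs \<subseteq> Basis \<longrightarrow> locally_moderate \<Omega> (\<lambda>\<epsilon>. partials vs (f \<epsilon>)))"
  unfolding moderate_def locally_moderate_def moderate_bound_def by blast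

lemma negligible_nets_iff_locally_negligible:
  "f \<in> negligible_nets \<Omega> \<longleftrightarrow> f \<in> smooth_nets \<Omega> \<and>
     (\<forall>vs. set vs \<subseteq> Basis \<longrightarrow> locally_negligible \<Omega> (\<lambda>\<epsilon>. partials vs (f \<epsilon>)))"
  unfolding negligible_nets_def locally_negligible_def negligible_bound_def by blast

lemma moderate_partial:
  assumes "f \<in> moderate \<Omega>" "v \<in> Basis"
  shows "(\<lambda>\<epsilon> x. frechet_derivative (f \<epsilon>) (at x) v) \<in> moderate \<Omega>"
  unfolding moderate_iff_locally_moderate
proof (intro conjI allI impI)
  show "(\<lambda>\<epsilon> x. frechet_derivative (f \<epsilon>) (at x) v) \<in> smooth_nets \<Omega>"
    using assms by (auto simp: moderate_def smooth_nets_def intro: smooth_on_partial)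
next
  fix vs :: "'a list" assume "set vs \<subseteq> Basis"
  then have "set (vs @ [v]) \<subseteq> Basis" using assms(2) by simp
  then have "locally_moderate \<Omega> (\<lambda>\<epsilon>. partials (vs @ [v]) (f \<epsilon>))"
    using assms(1) unfolding moderate_iff_locally_moderate by blast
  then show "locally_moderate \<Omega> (\<lambda>\<epsilon>. partials vs (\<lambda>x. frechet_derivative (f \<epsilon>) (at x) v))"
    by (simp add: partials_snoc)
qed

lemma moderate_imp_moderate_order: "f \<in> moderate \<Omega> \<Longrightarrow> moderate_order k \<Omega> f"
proof (induction k arbitrary: f)
  case 0
  then have "locally_moderate \<Omega> (\<lambda>\<epsilon>. partials [] (f \<epsilon>))"
    unfolding moderate_iff_locally_moderate by (metis empty_subsetI list.set(1))
  then show ?case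
    using 0 by (auto simp: moderate_def smooth_nets_def smooth_on_continuous)
next
  case (Suc k)
  then have "locally_moderate \<Omega> (\<lambda>\<epsilon>. partials [] (f \<epsilon>))"
    unfolding moderate_iff_locally_moderate by (metis empty_subsetI list.set(1))
  moreover have "\<forall>\<epsilon>\<in>{0<..1}. \<forall>x\<in>\<Omega>. f \<epsilon> differentiable (at x)"
    using Suc.prems by (auto simp: moderate_def smooth_nets_def smooth_on_differentiable)
  ultimately show ?case
    using Suc.IH moderate_partial[OF Suc.prems] by simp
qed

lemma moderate_order_imp_Ck_on:
  "moderate_order k \<Omega> f \<Longrightarrow> \<epsilon> \<in> {0<..1} \<Longrightarrow> Ck_on k \<Omega> (f \<epsilon>)"
proof (induction k arbitrary: f)
  case (Suc k)
  from Suc.IH[of "\<lambda>\<epsilon> x. frechet_derivative (f \<epsilon>) (at x) _"] Suc.prems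
  show ?case by simp
qed simp

lemma moderate_order_imp_moderate:
  assumes "\<And>k. moderate_order k \<Omega> f"
  shows "f \<in> moderate \<Omega>"
  unfolding moderate_iff_locally_moderate
proof (intro conjI allI impI)
  show "f \<in> smooth_nets \<Omega>"
    using moderate_order_imp_Ck_on[OF assms] by (simp add: smooth_nets_def smooth_on_def)
next
  fix vs :: "'a list" assume "set vs \<subseteq> Basis"
  moreover have "moderate_order (length vs) \<Omega> f" by (rule assms)
  ultimately show "locally_moderate \<Omega> (\<lambda>\<epsilon>. partials vs (f \<epsilon>))"
  proof (induction vs arbitrary: f rule: rev_induct)
    case (snoc v vs)
    from snoc.IH[of "\<lambda>\<epsilon> x. frechet_derivative (f \<epsilon>) (at x) v"] snoc.prems
    show ?case by (simp add: partials_snoc)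
  qed simp
qed

lemma locally_moderate_dominated:
  assumes "locally_moderate \<Omega> g"
    and "\<And>\<epsilon> x. \<epsilon> \<in> {0<..1} \<Longrightarrow> x \<in> \<Omega> \<Longrightarrow> norm (f \<epsilon> x) \<le> norm (g \<epsilon> x)"
  shows "locally_moderate \<Omega> f"
  unfolding locally_moderate_def
proof (intro allI impI)
  fix K assume "compact K" "K \<subseteq> \<Omega>"
  then show "moderate_bound K f"
    using assms by (intro moderate_bound_dominated[of K g f]) (auto simp: locally_moderate_def)
qed

lemma locally_negligible_dominated:
  assumes "locally_negligible \<Omega> g"
    and "\<And>\<epsilon> x. \<epsilon> \<in> {0<..1} \<Longrightarrow> x \<in> \<Omega> \<Longrightarrow> norm (f \<epsilon> x) \<le> norm (g \<epsilon> x)"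
  shows "locally_negligible \<Omega> f"
  unfolding locally_negligible_def
proof (intro allI impI)
  fix K assume "compact K" "K \<subseteq> \<Omega>"
  then show "negligible_bound K f"
    using assms by (intro negligible_bound_dominated[of K g f]) (auto simp: locally_negligible_def)
qed

lemma locally_moderate_add:
  assumes "locally_moderate \<Omega> f" "locally_moderate \<Omega> g"
  shows "locally_moderate \<Omega> (\<lambda>\<epsilon> x. f \<epsilon> x + g \<epsilon> x)"
  using assms unfolding locally_moderate_def by (intro allI impI moderate_bound_add) blast+

lemma locally_negligible_add:
  assumes "locally_negligible \<Omega> f" "locally_negligible \<Omega> g"
  shows "locally_negligible \<Omega> (\<lambda>\<epsilon> x. f \<epsilon> x + g \<epsilon> x)"
  using assms unfolding locally_negligible_def by (intro allI impI negligible_bound_add) blast+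

lemma locally_negligible_linear:
  assumes "bounded_linear L" "locally_negligible \<Omega> f"
  shows "locally_negligible \<Omega> (\<lambda>\<epsilon> x. L (f \<epsilon> x))"
proof -
  obtain C where C: "\<And>a. norm (L a) \<le> norm a * C"
    using assms(1) bounded_linear.bounded by blast
  have "negligible_bound K (\<lambda>\<epsilon> x. L (f \<epsilon> x))" if "compact K" "K \<subseteq> \<Omega>" for K
  proof -
    have "negligible_bound K (\<lambda>\<epsilon> x. norm (f \<epsilon> x))"
      using assms(2) that by (simp add: negligible_bound_norm_iff locally_negligible_def)
    from negligible_bound_mult[OF moderate_bound_const[of K C] this]
    show ?thesis
      by (rule negligible_bound_dominated)
        (unfold real_norm_def, rule order_trans[OF order_trans[OF C] abs_ge_self], simp add: mult.commute)
  qed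
  then show ?thesis unfolding locally_negligible_def by blast
qed

lemma locally_negligible_sum:
  fixes f :: "'i \<Rightarrow> ('a::topological_space, 'b::real_normed_vector) net"
  assumes "finite A" "\<And>i. i \<in> A \<Longrightarrow> locally_negligible \<Omega> (f i)"
  shows "locally_negligible \<Omega> (\<lambda>\<epsilon> x. \<Sum>i\<in>A. f i \<epsilon> x)"
  using assms
proof (induction A)
  case empty
  show ?case by (simp add: locally_negligible_def negligible_bound_def exI[of _ 0])
next
  case (insert i A)
  have "locally_negligible \<Omega> (\<lambda>\<epsilon> x. f i \<epsilon> x + (\<Sum>i\<in>A. f i \<epsilon> x))"
    by (rule locally_negligible_add) (use insert in auto)
  then show ?case using insert.hyps by simp
qed

lemma locally_negligible_swap:
  assumes "locally_negligible \<Omega> (\<lambda>\<epsilon> x. u \<epsilon> x - v \<epsilon> x)"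
  shows "locally_negligible \<Omega> (\<lambda>\<epsilon> x. v \<epsilon> x - u \<epsilon> x)"
  using assms by (rule locally_negligible_dominated) (simp add: norm_minus_commute)

lemma locally_negligible_diff_trans:
  assumes "locally_negligible \<Omega> (\<lambda>\<epsilon> x. u \<epsilon> x - v \<epsilon> x)"
    and "locally_negligible \<Omega> (\<lambda>\<epsilon> x. v \<epsilon> x - w \<epsilon> x)"
  shows "locally_negligible \<Omega> (\<lambda>\<epsilon> x. u \<epsilon> x - w \<epsilon> x)"
  using locally_negligible_add[OF assms] by simp

lemma locally_moderate_linear:
  assumes "bounded_linear L" "locally_moderate \<Omega> f"
  shows "locally_moderate \<Omega> (\<lambda>\<epsilon> x. L (f \<epsilon> x))"
  using assms(2) unfolding locally_moderate_def
  by (intro allI impI moderate_bound_linear[OF assms(1)]) blast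

lemma locally_moderate_bilinear:
  assumes "bounded_bilinear B" "locally_moderate \<Omega> f" "locally_moderate \<Omega> g"
  shows "locally_moderate \<Omega> (\<lambda>\<epsilon> x. B (f \<epsilon> x) (g \<epsilon> x))"
  using assms(2,3) unfolding locally_moderate_def
  by (intro allI impI moderate_bound_bilinear[OF assms(1)]) blast+

lemma locally_moderate_const:
  assumes "moderate_bound UNIV (\<lambda>\<epsilon> x::'a::topological_space. c \<epsilon>)"
  shows "locally_moderate (\<Omega>::'a set) (\<lambda>\<epsilon> x. c \<epsilon>)"
  unfolding locally_moderate_def by (intro allI impI moderate_bound_subset[OF assms] subset_UNIV)

lemma locally_moderate_const_continuous:
  assumes "continuous_on \<Omega> f"
  shows "locally_moderate \<Omega> (\<lambda>\<epsilon>. f)"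
  unfolding locally_moderate_def
proof (intro allI impI)
  fix K assume K: "compact K" "K \<subseteq> \<Omega>"
  then have "bounded (f ` K)"
    using assms compact_continuous_image compact_imp_bounded continuous_on_subset by metis
  then obtain B where "\<And>x. x \<in> K \<Longrightarrow> norm (f x) \<le> B"
    unfolding bounded_iff by blast
  then show "moderate_bound K (\<lambda>\<epsilon>. f)" by (rule moderate_bound_bounded)
qed

lemma locally_moderate_compose_continuous:
  assumes "locally_moderate S f" "continuous_on \<Omega> \<psi>" "\<psi> ` \<Omega> \<subseteq> S"
  shows "locally_moderate \<Omega> (\<lambda>\<epsilon> x. f \<epsilon> (\<psi> x))"
  unfolding locally_moderate_def
proof (intro allI impI)
  fix K assume "compact K" "K \<subseteq> \<Omega>"
  then have "compact (\<psi> ` K)" "\<psi> ` K \<subseteq> S"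
    using assms(2,3) compact_continuous_image continuous_on_subset by blast+
  then have "moderate_bound (\<psi> ` K) f"
    using assms(1) unfolding locally_moderate_def by blast
  then show "moderate_bound K (\<lambda>\<epsilon> x. f \<epsilon> (\<psi> x))"
    by (rule moderate_bound_compose_image)
qed

lemma locally_negligible_compose_continuous:
  assumes "locally_negligible S f" "continuous_on \<Omega> \<psi>" "\<psi> ` \<Omega> \<subseteq> S"
  shows "locally_negligible \<Omega> (\<lambda>\<epsilon> x. f \<epsilon> (\<psi> x))"
  unfolding locally_negligible_def
proof (intro allI impI)
  fix K assume "compact K" "K \<subseteq> \<Omega>"
  then have "compact (\<psi> ` K)" "\<psi> ` K \<subseteq> S"
    using assms(2,3) compact_continuous_image continuous_on_subset by blast+
  then have "negligible_bound (\<psi> ` K) f"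
    using assms(1) unfolding locally_negligible_def by blast
  then show "negligible_bound K (\<lambda>\<epsilon> x. f \<epsilon> (\<psi> x))"
    by (rule negligible_bound_compose_image)
qed

lemma moderate_order_cong:
  assumes "open \<Omega>"
    and "moderate_order k \<Omega> f"
    and "\<And>\<epsilon> x. \<epsilon> \<in> {0<..1} \<Longrightarrow> x \<in> \<Omega> \<Longrightarrow> f \<epsilon> x = g \<epsilon> x"
  shows "moderate_order k \<Omega> g"
  using assms(2,3)
proof (induction k arbitrary: f g)
  case 0
  have "locally_moderate \<Omega> g"
    using 0 by (intro locally_moderate_dominated[of \<Omega> f g]) auto
  moreover have "\<forall>\<epsilon>\<in>{0<..1}. continuous_on \<Omega> (g \<epsilon>)"
  proof
    fix \<epsilon> :: real assume "\<epsilon> \<in> {0<..1}"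
    then show "continuous_on \<Omega> (g \<epsilon>)"
      using 0 continuous_on_cong[OF refl, of \<Omega> "f \<epsilon>" "g \<epsilon>"] by auto
  qed
  ultimately show ?case by simp
next
  case (Suc k)
  have "locally_moderate \<Omega> g"
    using Suc.prems by (intro locally_moderate_dominated[of \<Omega> f g]) auto
  moreover have "g \<epsilon> differentiable (at x)" if "\<epsilon> \<in> {0<..1}" "x \<in> \<Omega>" for \<epsilon> x
    using differentiable_cong_open[OF assms(1) that(2), of "f \<epsilon>" "g \<epsilon>"] Suc.prems that by auto
  moreover have "moderate_order k \<Omega> (\<lambda>\<epsilon> x. frechet_derivative (g \<epsilon>) (at x) v)" if "v \<in> Basis" for v
  proof (rule Suc.IH)
    show "moderate_order k \<Omega> (\<lambda>\<epsilon> x. frechet_derivative (f \<epsilon>) (at x) v)"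
      using Suc.prems that by simp
    show "frechet_derivative (f \<epsilon>) (at x) v = frechet_derivative (g \<epsilon>) (at x) v"
      if "\<epsilon> \<in> {0<..1}" "x \<in> \<Omega>" for \<epsilon> x
      using frechet_derivative_cong_open[OF assms(1) that(2), of "f \<epsilon>" "g \<epsilon>"] Suc.prems that by auto
  qed
  ultimately show ?case by simp
qed

lemma moderate_order_SucD: "moderate_order (Suc k) \<Omega> f \<Longrightarrow> moderate_order k \<Omega> f"
proof (induction k arbitrary: f)
  case 0
  then show ?case
    by (auto intro!: differentiable_imp_continuous_on
      simp: differentiable_on_def differentiable_at_withinI)
next
  case (Suc k)
  then show ?case by simp
qed

text \<open>On an open set the derivatives may be given by any explicit formula.\<close>

lemma moderate_order_SucI:
  assumes "open \<Omega>" "locally_moderate \<Omega> f"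
    and "\<And>\<epsilon> x. \<epsilon> \<in> {0<..1} \<Longrightarrow> x \<in> \<Omega> \<Longrightarrow> (f \<epsilon> has_derivative f' \<epsilon> x) (at x)"
    and "\<And>v. v \<in> Basis \<Longrightarrow> moderate_order k \<Omega> (\<lambda>\<epsilon> x. f' \<epsilon> x v)"
  shows "moderate_order (Suc k) \<Omega> f"
proof -
  have "f \<epsilon> differentiable (at x)" if "\<epsilon> \<in> {0<..1}" "x \<in> \<Omega>" for \<epsilon> x
    using assms(3)[OF that] by (auto simp: differentiable_def)
  moreover have "moderate_order k \<Omega> (\<lambda>\<epsilon> x. frechet_derivative (f \<epsilon>) (at x) v)" if "v \<in> Basis" for v
    using assms(1) assms(4)[OF that]
    by (rule moderate_order_cong) (simp add: frechet_derivative_eqI[OF assms(3)])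
  ultimately show ?thesis using assms(2) by simp
qed

lemma moderate_order_SucE:
  assumes "moderate_order (Suc k) \<Omega> f"
  shows "locally_moderate \<Omega> f"
    and "\<And>\<epsilon> x. \<epsilon> \<in> {0<..1} \<Longrightarrow> x \<in> \<Omega> \<Longrightarrow>
        (f \<epsilon> has_derivative frechet_derivative (f \<epsilon>) (at x)) (at x)"
    and "\<And>v. v \<in> Basis \<Longrightarrow> moderate_order k \<Omega> (\<lambda>\<epsilon> x. frechet_derivative (f \<epsilon>) (at x) v)"
  using assms by (auto simp flip: frechet_derivative_works)

lemma moderate_order_const:
  assumes "open \<Omega>" "moderate_bound UNIV (\<lambda>\<epsilon> x::'a::euclidean_space. c \<epsilon>)"
  shows "moderate_order k (\<Omega>::'a set) (\<lambda>\<epsilon> x. c \<epsilon>)"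
  using assms(2)
proof (induction k arbitrary: c)
  case 0
  then show ?case using locally_moderate_const by simp
next
  case (Suc k)
  have "locally_moderate \<Omega> (\<lambda>\<epsilon> x. c \<epsilon>)"
    using Suc.prems by (rule locally_moderate_const)
  moreover have "moderate_order k \<Omega> (\<lambda>(\<epsilon>::real) x. 0::'b)"
    by (rule Suc.IH) (rule moderate_bound_const)
  ultimately show ?case
    by (intro moderate_order_SucI[OF assms(1), of _ "\<lambda>\<epsilon> x h. 0"]) auto
qed

lemma moderate_order_linear:
  assumes "open \<Omega>" "bounded_linear L" "moderate_order k \<Omega> f"
  shows "moderate_order k \<Omega> (\<lambda>\<epsilon> x. L (f \<epsilon> x))"
  using assms(3)
proof (induction k arbitrary: f)
  case 0
  then show ?case
    using assms(2) by (simp add: locally_moderate_linear bounded_linear.continuous_on)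
next
  case (Suc k)
  note f = moderate_order_SucE[OF Suc.prems]
  show ?case
  proof (rule moderate_order_SucI[OF assms(1)])
    show "locally_moderate \<Omega> (\<lambda>\<epsilon> x. L (f \<epsilon> x))"
      by (rule locally_moderate_linear[OF assms(2) f(1)])
    show "((\<lambda>x. L (f \<epsilon> x)) has_derivative (\<lambda>h. L (frechet_derivative (f \<epsilon>) (at x) h))) (at x)"
      if "\<epsilon> \<in> {0<..1}" "x \<in> \<Omega>" for \<epsilon> x
      using bounded_linear.has_derivative[OF assms(2) f(2)[OF that]] .
    show "moderate_order k \<Omega> (\<lambda>\<epsilon> x. L (frechet_derivative (f \<epsilon>) (at x) v))" if "v \<in> Basis" for v
      using Suc.IH[OF f(3)[OF that]] .
  qed
qed

lemma moderate_order_add: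
  assumes "open \<Omega>" "moderate_order k \<Omega> f" "moderate_order k \<Omega> g"
  shows "moderate_order k \<Omega> (\<lambda>\<epsilon> x. f \<epsilon> x + g \<epsilon> x)"
  using assms(2,3)
proof (induction k arbitrary: f g)
  case 0
  then show ?case
    by (auto intro!: locally_moderate_add continuous_on_add)
next
  case (Suc k)
  note f = moderate_order_SucE[OF Suc.prems(1)] and g = moderate_order_SucE[OF Suc.prems(2)]
  show ?case
  proof (rule moderate_order_SucI[OF assms(1)])
    show "locally_moderate \<Omega> (\<lambda>\<epsilon> x. f \<epsilon> x + g \<epsilon> x)"
      using f(1) g(1) by (rule locally_moderate_add)
    show "((\<lambda>x. f \<epsilon> x + g \<epsilon> x) has_derivative
        (\<lambda>h. frechet_derivative (f \<epsilon>) (at x) h + frechet_derivative (g \<epsilon>) (at x) h)) (at x)"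
      if "\<epsilon> \<in> {0<..1}" "x \<in> \<Omega>" for \<epsilon> x
      using has_derivative_add[OF f(2)[OF that] g(2)[OF that]] .
    show "moderate_order k \<Omega> (\<lambda>\<epsilon> x. frechet_derivative (f \<epsilon>) (at x) v + frechet_derivative (g \<epsilon>) (at x) v)"
      if "v \<in> Basis" for v
      using Suc.IH[OF f(3)[OF that] g(3)[OF that]] .
  qed
qed

lemma moderate_order_sum:
  assumes "open \<Omega>" "finite A" "\<And>i. i \<in> A \<Longrightarrow> moderate_order k \<Omega> (f i)"
  shows "moderate_order k \<Omega> (\<lambda>\<epsilon> x. \<Sum>i\<in>A. f i \<epsilon> x)"
  using assms(2,3)
proof (induction A)
  case empty
  show ?case using moderate_order_const[OF assms(1) moderate_bound_const] by simp
next
  case (insert a A)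
  have "moderate_order k \<Omega> (\<lambda>\<epsilon> x. f a \<epsilon> x + (\<Sum>i\<in>A. f i \<epsilon> x))"
    by (rule moderate_order_add[OF assms(1)]) (use insert in auto)
  then show ?case using insert.hyps by simp
qed

lemma moderate_order_bilinear:
  assumes "open \<Omega>" "bounded_bilinear B" "moderate_order k \<Omega> f" "moderate_order k \<Omega> g"
  shows "moderate_order k \<Omega> (\<lambda>\<epsilon> x. B (f \<epsilon> x) (g \<epsilon> x))"
  using assms(3,4)
proof (induction k arbitrary: f g)
  case 0
  then show ?case
    by (simp add: locally_moderate_bilinear[OF assms(2)] bounded_bilinear.continuous_on[OF assms(2)])
next
  case (Suc k)
  note f = moderate_order_SucE[OF Suc.prems(1)] and g = moderate_order_SucE[OF Suc.prems(2)]
  show ?case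
  proof (rule moderate_order_SucI[OF assms(1)])
    show "locally_moderate \<Omega> (\<lambda>\<epsilon> x. B (f \<epsilon> x) (g \<epsilon> x))"
      by (rule locally_moderate_bilinear[OF assms(2) f(1) g(1)])
    show "((\<lambda>x. B (f \<epsilon> x) (g \<epsilon> x)) has_derivative
        (\<lambda>h. B (f \<epsilon> x) (frechet_derivative (g \<epsilon>) (at x) h) + B (frechet_derivative (f \<epsilon>) (at x) h) (g \<epsilon> x))) (at x)"
      if "\<epsilon> \<in> {0<..1}" "x \<in> \<Omega>" for \<epsilon> x
      using bounded_bilinear.FDERIV[OF assms(2) f(2)[OF that] g(2)[OF that]] .
    show "moderate_order k \<Omega> (\<lambda>\<epsilon> x. B (f \<epsilon> x) (frechet_derivative (g \<epsilon>) (at x) v)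
        + B (frechet_derivative (f \<epsilon>) (at x) v) (g \<epsilon> x))"
      if "v \<in> Basis" for v
      by (rule moderate_order_add[OF assms(1)
            Suc.IH[OF moderate_order_SucD[OF Suc.prems(1)] g(3)[OF that]]
            Suc.IH[OF f(3)[OF that] moderate_order_SucD[OF Suc.prems(2)]]])
  qed
qed

lemma moderate_order_ident:
  assumes "open \<Omega>"
  shows "moderate_order k \<Omega> (\<lambda>\<epsilon> x. x)"
proof (cases k)
  case 0
  then show ?thesis using locally_moderate_const_continuous[OF continuous_on_id] by simp
next
  case (Suc j)
  have "moderate_order (Suc j) \<Omega> (\<lambda>\<epsilon> x. x)"
    by (rule moderate_order_SucI[OF assms, of _ "\<lambda>\<epsilon> x h. h"])
       (auto intro!: locally_moderate_const_continuous continuous_on_id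
         moderate_order_const[OF assms moderate_bound_const])
  then show ?thesis using Suc by simp
qed

text \<open>By the chain rule the derivative of \<open>F \<epsilon> \<circ> \<phi> \<epsilon>\<close> along \<open>v\<close> is a sum of products of components of
  \<open>\<partial>\<^sub>v \<phi>\<close> with nets \<open>\<partial>\<^sub>b F \<circ> \<phi>\<close>, and \<open>\<partial>\<^sub>b F\<close> satisfies the same hypotheses as \<open>F\<close>.
  The growth of \<open>F\<close> is restricted only along \<open>\<phi>\<close>. This form covers a net composed with a fixed
  map, and also a fixed function evaluated at a net whose values leave every bounded set as \<open>\<epsilon>\<close>
  tends to \<open>0\<close>.\<close>

lemma moderate_order_compose:
  fixes F :: "('a::euclidean_space, 'b::real_normed_vector) net"
    and \<phi> :: "('c::euclidean_space, 'a) net"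
  assumes "open \<Omega>"
    and "\<And>\<epsilon> x. \<epsilon> \<in> {0<..1} \<Longrightarrow> x \<in> \<Omega> \<Longrightarrow> \<phi> \<epsilon> x \<in> S"
    and "moderate_order k \<Omega> \<phi>"
    and "\<And>\<epsilon>. \<epsilon> \<in> {0<..1} \<Longrightarrow> smooth_on S (F \<epsilon>)" "open S"
    and "\<And>vs. set vs \<subseteq> Basis \<Longrightarrow> locally_moderate \<Omega> (\<lambda>\<epsilon> x. partials vs (F \<epsilon>) (\<phi> \<epsilon> x))"
  shows "moderate_order k \<Omega> (\<lambda>\<epsilon> x. F \<epsilon> (\<phi> \<epsilon> x))"
  using assms(3,4,6)
proof (induction k arbitrary: F)
  case 0
  have "locally_moderate \<Omega> (\<lambda>\<epsilon> x. F \<epsilon> (\<phi> \<epsilon> x))"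
    using 0(3)[of "[]"] by simp
  moreover have "continuous_on \<Omega> (\<lambda>x. F \<epsilon> (\<phi> \<epsilon> x))" if "\<epsilon> \<in> {0<..1}" for \<epsilon>
  proof (rule continuous_on_compose2[of S "F \<epsilon>" \<Omega> "\<phi> \<epsilon>"])
    show "continuous_on S (F \<epsilon>)" using 0(2)[OF that] by (rule smooth_on_continuous)
    show "continuous_on \<Omega> (\<phi> \<epsilon>)" using 0(1) that by simp
    show "\<phi> \<epsilon> ` \<Omega> \<subseteq> S" using assms(2) that by blast
  qed
  ultimately show ?case by simp
next
  case (Suc k)
  note \<phi> = moderate_order_SucE[OF Suc.prems(1)]
  show ?case
  proof (rule moderate_order_SucI[OF assms(1)])
    show "locally_moderate \<Omega> (\<lambda>\<epsilon> x. F \<epsilon> (\<phi> \<epsilon> x))"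
      using Suc.prems(3)[of "[]"] by simp
    show "((\<lambda>x. F \<epsilon> (\<phi> \<epsilon> x)) has_derivative (\<lambda>h. \<Sum>b\<in>Basis.
         (frechet_derivative (\<phi> \<epsilon>) (at x) h \<bullet> b) *\<^sub>R frechet_derivative (F \<epsilon>) (at (\<phi> \<epsilon> x)) b)) (at x)"
      if "\<epsilon> \<in> {0<..1}" "x \<in> \<Omega>" for \<epsilon> x
    proof -
      have d: "F \<epsilon> differentiable (at (\<phi> \<epsilon> x))"
        using Suc.prems(2) assms(2) that smooth_on_differentiable by blast
      show ?thesis
        using has_derivative_compose[OF \<phi>(2)[OF that] d[unfolded frechet_derivative_works]]
        unfolding frechet_derivative_basis_expansion[OF d, of "frechet_derivative (\<phi> \<epsilon>) (at x) _"] .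
    qed
    show "moderate_order k \<Omega> (\<lambda>\<epsilon> x. \<Sum>b\<in>Basis.
         (frechet_derivative (\<phi> \<epsilon>) (at x) v \<bullet> b) *\<^sub>R frechet_derivative (F \<epsilon>) (at (\<phi> \<epsilon> x)) b)"
      if "v \<in> Basis" for v
    proof (rule moderate_order_sum[OF assms(1) finite_Basis])
      fix b :: 'a assume b: "b \<in> Basis"
      have 1: "moderate_order k \<Omega> (\<lambda>\<epsilon> x. frechet_derivative (\<phi> \<epsilon>) (at x) v \<bullet> b)"
        by (rule moderate_order_linear[OF assms(1) bounded_linear_inner_left \<phi>(3)[OF that]])
      have 2: "moderate_order k \<Omega> (\<lambda>\<epsilon> x. frechet_derivative (F \<epsilon>) (at (\<phi> \<epsilon> x)) b)"
      proof (rule Suc.IH)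
        show "moderate_order k \<Omega> \<phi>" using Suc.prems(1) by (rule moderate_order_SucD)
        show "smooth_on S (\<lambda>x. frechet_derivative (F \<epsilon>) (at x) b)" if "\<epsilon> \<in> {0<..1}" for \<epsilon>
          using Suc.prems(2)[OF that] b by (rule smooth_on_partial)
        show "locally_moderate \<Omega> (\<lambda>\<epsilon> x. partials vs (\<lambda>x. frechet_derivative (F \<epsilon>) (at x) b) (\<phi> \<epsilon> x))"
          if "set vs \<subseteq> Basis" for vs
          using Suc.prems(3)[of "vs @ [b]"] that b by (simp add: partials_snoc)
      qed
      show "moderate_order k \<Omega> (\<lambda>\<epsilon> x. (frechet_derivative (\<phi> \<epsilon>) (at x) v \<bullet> b) *\<^sub>R
          frechet_derivative (F \<epsilon>) (at (\<phi> \<epsilon> x)) b)"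
        by (rule moderate_order_bilinear[OF assms(1) bounded_bilinear_scaleR 1 2])
    qed
  qed
qed

section \<open>Negligibility from the values alone\<close>

text \<open>Interpolation in the manner of Landau and Kolmogorov: \<open>h \<cdot> \<partial>\<^sub>v f(x)\<close> differs from
  \<open>f(x + h v) - f(x)\<close> by at most \<open>h\<^sup>2 B\<close>.\<close>

lemma partial_bound_from_second_partial:
  fixes f :: "'a::real_normed_vector \<Rightarrow> 'b::real_normed_vector" and v :: 'a
  defines "d \<equiv> (\<lambda>y. frechet_derivative f (at y) v)"
  defines "dd \<equiv> (\<lambda>y. frechet_derivative d (at y) v)"
  assumes "0 < h"
    and f: "\<And>t. t \<in> {0..h} \<Longrightarrow> f differentiable (at (x + t *\<^sub>R v))"
    and d: "\<And>t. t \<in> {0..h} \<Longrightarrow> d differentiable (at (x + t *\<^sub>R v))"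
    and B: "\<And>t. t \<in> {0..h} \<Longrightarrow> norm (dd (x + t *\<^sub>R v)) \<le> B"
    and A: "norm (f x) \<le> A" "norm (f (x + h *\<^sub>R v)) \<le> A"
  shows "norm (d x) \<le> 2 * A / h + h * B"
proof -
  have line: "((\<lambda>t. k (x + t *\<^sub>R v)) has_vector_derivative frechet_derivative k (at (x + t *\<^sub>R v)) v)
      (at t within {0..h})"
    if "k differentiable (at (x + t *\<^sub>R v))" for k :: "'a \<Rightarrow> 'b" and t
  proof -
    have k: "(k has_derivative frechet_derivative k (at (x + t *\<^sub>R v))) (at (x + t *\<^sub>R v))"
      using that frechet_derivative_works by blast
    have "((\<lambda>t. x + t *\<^sub>R v) has_derivative (\<lambda>s. s *\<^sub>R v)) (at t within {0..h})"
      by (auto intro!: derivative_eq_intros)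
    from has_derivative_compose[OF this k]
    show ?thesis
      using linear_frechet_derivative[OF that]
      by (simp add: has_vector_derivative_def linear_scale)
  qed
  have B0: "0 \<le> B" using order_trans[OF norm_ge_zero B, of 0] \<open>0 < h\<close> by simp
  have "norm (d (x + t *\<^sub>R v) - d (x + 0 *\<^sub>R v)) \<le> h * B" if t: "t \<in> {0..h}" for t
  proof -
    have "norm (d (x + t *\<^sub>R v) - d (x + 0 *\<^sub>R v)) \<le> B * norm (t - 0)"
    proof (rule differentiable_bound[of "{0..h}" "\<lambda>t. d (x + t *\<^sub>R v)" "\<lambda>t s. s *\<^sub>R dd (x + t *\<^sub>R v)"])
      show "((\<lambda>t. d (x + t *\<^sub>R v)) has_derivative (\<lambda>s. s *\<^sub>R dd (x + t *\<^sub>R v))) (at t within {0..h})"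
        if "t \<in> {0..h}" for t
        using line[OF d[OF that]] by (simp add: has_vector_derivative_def dd_def)
      show "onorm (\<lambda>s. s *\<^sub>R dd (x + t *\<^sub>R v)) \<le> B" if "t \<in> {0..h}" for t
        using B[OF that] by (intro onorm_le) (auto simp: mult.commute[of B] intro: mult_left_mono)
    qed (use t \<open>0 < h\<close> in auto)
    also have "\<dots> \<le> B * h" using t B0 by (intro mult_left_mono) auto
    finally show ?thesis by (simp add: mult.commute)
  qed
  then have "norm (f (x + h *\<^sub>R v) - f (x + 0 *\<^sub>R v) - (h - 0) *\<^sub>R d (x + 0 *\<^sub>R v)) \<le> norm (h - 0) * (h * B)"
    using \<open>0 < h\<close> line[OF f]
    by (intro vector_differentiable_bound_linearization[where S = "{0..h}"
          and f = "\<lambda>t. f (x + t *\<^sub>R v)" and f' = "\<lambda>t. d (x + t *\<^sub>R v)"])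
      (auto simp: d_def closed_segment_eq_real_ivl)
  then have *: "norm (f (x + h *\<^sub>R v) - f x - h *\<^sub>R d x) \<le> h * (h * B)"
    using \<open>0 < h\<close> by simp
  have "h *\<^sub>R d x = f (x + h *\<^sub>R v) - f x - (f (x + h *\<^sub>R v) - f x - h *\<^sub>R d x)"
    by simp
  then have "norm (h *\<^sub>R d x) \<le> A + A + h * (h * B)"
    using A * norm_triangle_ineq4 by (smt (verit))
  then show ?thesis
    using \<open>0 < h\<close> by (simp add: field_simps)
qed

text \<open>If the second derivative is \<open>O(\<epsilon>\<^sup>-\<^sup>N)\<close> and the values are \<open>O(\<epsilon>\<^bsup>2m+N\<^esup>)\<close>, then a step of size
  \<open>\<epsilon>\<^bsup>m+N\<^esup>\<close> balances both terms of the interpolation estimate at \<open>O(\<epsilon>\<^sup>m)\<close>. The estimates are needed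
  on a compact neighbourhood \<open>L\<close> of \<open>K\<close>, which contains all the steps.\<close>

lemma locally_negligible_partial:
  fixes f :: "('a::euclidean_space, 'b::real_normed_vector) net"
  assumes "open \<Omega>" "f \<in> moderate \<Omega>" "locally_negligible \<Omega> f" "v \<in> Basis"
  shows "locally_negligible \<Omega> (\<lambda>\<epsilon> x. frechet_derivative (f \<epsilon>) (at x) v)"
  unfolding locally_negligible_def
proof (intro allI impI)
  fix K assume K: "compact K" "K \<subseteq> \<Omega>"
  define d where "d = (\<lambda>\<epsilon> x. frechet_derivative (f \<epsilon>) (at x) v)"
  define dd where "dd = (\<lambda>\<epsilon> x. frechet_derivative (d \<epsilon>) (at x) v)"
  have d: "d \<in> moderate \<Omega>"
    unfolding d_def using assms by (intro moderate_partial)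
  then have dd: "dd \<in> moderate \<Omega>"
    unfolding dd_def using assms by (intro moderate_partial)
  obtain \<delta> where \<delta>: "\<delta> > 0" "(\<Union>x\<in>K. cball x \<delta>) \<subseteq> \<Omega>"
    using compact_subset_open_imp_cball_epsilon_subset[OF K(1) assms(1) K(2)] by blast
  define L where "L = (\<Union>x\<in>K. \<Union>y\<in>cball 0 \<delta>. {x + y})"
  have "compact L" unfolding L_def using K(1) compact_cball by (rule compact_sums')
  have L: "x + y \<in> L" if "x \<in> K" "norm y \<le> \<delta>" for x y
  proof -
    have "y \<in> cball 0 \<delta>" using that by simp
    then show ?thesis using that(1) unfolding L_def by blast
  qed
  have "L \<subseteq> \<Omega>"
  proof
    fix z assume "z \<in> L"
    then obtain x y where "x \<in> K" "norm y \<le> \<delta>" "z = x + y" by (auto simp: L_def)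
    then have "z \<in> cball x \<delta>" by (simp add: dist_norm)
    then show "z \<in> \<Omega>" using \<delta> \<open>x \<in> K\<close> by blast
  qed
  have "moderate_bound L dd"
    using moderate_order_locally_moderate[OF moderate_imp_moderate_order[OF dd, of 0]]
      \<open>compact L\<close> \<open>L \<subseteq> \<Omega>\<close> by (auto simp: locally_moderate_def)
  then obtain N B where B: "B \<ge> 0" "\<forall>\<^sub>F \<epsilon> in at_right 0. \<forall>x\<in>L. norm (dd \<epsilon> x) \<le> B * inverse \<epsilon> ^ N"
    by (rule moderate_boundE)
  have fL: "negligible_bound L f"
    using assms(3) \<open>compact L\<close> \<open>L \<subseteq> \<Omega>\<close> by (auto simp: locally_negligible_def)
  show "negligible_bound K (\<lambda>\<epsilon> x. frechet_derivative (f \<epsilon>) (at x) v)"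
    unfolding negligible_bound_def
  proof
    fix m
    obtain A where A: "A \<ge> 0" "\<forall>\<^sub>F \<epsilon> in at_right 0. \<forall>x\<in>L. norm (f \<epsilon> x) \<le> A * \<epsilon> ^ (2 * m + N)"
      using fL by (rule negligible_boundE)
    from A(2) B(2) eventually_unit_interval
    have "\<forall>\<^sub>F \<epsilon> in at_right 0. \<forall>x\<in>K. norm (d \<epsilon> x) \<le> (2 * A / \<delta> + \<delta> * B) * \<epsilon> ^ m"
    proof eventually_elim
      case (elim \<epsilon>)
      show ?case
      proof
        fix x assume x: "x \<in> K"
        define h where "h = \<delta> * \<epsilon> ^ (m + N)"
        have h: "0 < h" "h \<le> \<delta>"
          using elim(3) \<open>\<delta> > 0\<close> by (auto simp: h_def mult_le_cancel_left1 power_le_one)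
        have tL: "x + t *\<^sub>R v \<in> L" if "t \<in> {0..h}" for t
          using that h \<open>v \<in> Basis\<close> by (intro L[OF x]) auto
        have "norm (d \<epsilon> x) \<le> 2 * (A * \<epsilon> ^ (2 * m + N)) / h + h * (B * inverse \<epsilon> ^ N)"
          unfolding d_def
        proof (rule partial_bound_from_second_partial[OF h(1)])
          fix t assume t: "t \<in> {0..h}"
          show "f \<epsilon> differentiable at (x + t *\<^sub>R v)"
            using assms(2) tL[OF t] \<open>L \<subseteq> \<Omega>\<close> elim(3)
            by (auto simp: moderate_def smooth_nets_def intro!: smooth_on_differentiable)
          have "d \<epsilon> differentiable at (x + t *\<^sub>R v)"
            using d tL[OF t] \<open>L \<subseteq> \<Omega>\<close> elim(3)
            by (auto simp: moderate_def smooth_nets_def intro!: smooth_on_differentiable)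
          then show "(\<lambda>y. frechet_derivative (f \<epsilon>) (at y) v) differentiable at (x + t *\<^sub>R v)"
            by (simp add: d_def)
          show "norm (frechet_derivative (\<lambda>y. frechet_derivative (f \<epsilon>) (at y) v) (at (x + t *\<^sub>R v)) v)
              \<le> B * inverse \<epsilon> ^ N"
            using elim(2) tL[OF t] by (simp add: dd_def d_def)
        next
          show "norm (f \<epsilon> x) \<le> A * \<epsilon> ^ (2 * m + N)"
            using elim(1) tL[of 0] h by simp
          show "norm (f \<epsilon> (x + h *\<^sub>R v)) \<le> A * \<epsilon> ^ (2 * m + N)"
            using elim(1) tL[of h] h by simp
        qed
        also have "\<dots> = (2 * A / \<delta> + \<delta> * B) * \<epsilon> ^ m"
        proof -
          have 1: "\<epsilon> ^ (2 * m + N) = \<epsilon> ^ (m + N) * \<epsilon> ^ m"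
            unfolding power_add[symmetric] by (rule arg_cong[of _ _ "(^) \<epsilon>"]) simp
          have 2: "\<epsilon> ^ (m + N) * inverse \<epsilon> ^ N = \<epsilon> ^ m"
            using elim(3) by (simp add: power_add power_inverse)
          have "2 * (A * \<epsilon> ^ (2 * m + N)) / h = 2 * A / \<delta> * \<epsilon> ^ m"
            using elim(3) \<open>\<delta> > 0\<close> unfolding 1 h_def by simp
          moreover have "h * (B * inverse \<epsilon> ^ N) = \<delta> * B * (\<epsilon> ^ (m + N) * inverse \<epsilon> ^ N)"
            unfolding h_def by (simp only: mult_ac)
          ultimately show ?thesis unfolding 2 by (simp only: distrib_right)
        qed
        finally show "norm (d \<epsilon> x) \<le> (2 * A / \<delta> + \<delta> * B) * \<epsilon> ^ m" .
      qed
    qed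
    then show "\<exists>C. \<forall>\<^sub>F \<epsilon> in at_right 0. \<forall>x\<in>K. norm (frechet_derivative (f \<epsilon>) (at x) v) \<le> C * \<epsilon> ^ m"
      unfolding d_def by blast
  qed
qed

lemma moderate_partials:
  assumes "f \<in> moderate \<Omega>" "set vs \<subseteq> Basis"
  shows "(\<lambda>\<epsilon>. partials vs (f \<epsilon>)) \<in> moderate \<Omega>"
  using assms(2)
proof (induction vs)
  case (Cons v vs)
  then show ?case using moderate_partial[of "\<lambda>\<epsilon>. partials vs (f \<epsilon>)" \<Omega> v] by simp
qed (simp add: assms(1))

text \<open>Each further derivative of a moderate net inherits negligibility from the preceding one, so
  differences of nets have to be estimated in their values only.\<close>

theorem negligible_iff_locally_negligible:
  fixes f :: "('a::euclidean_space, 'b::real_normed_vector) net"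
  assumes "open \<Omega>" "f \<in> moderate \<Omega>"
  shows "f \<in> negligible_nets \<Omega> \<longleftrightarrow> locally_negligible \<Omega> f"
proof
  assume "f \<in> negligible_nets \<Omega>"
  then have "locally_negligible \<Omega> (\<lambda>\<epsilon>. partials [] (f \<epsilon>))"
    unfolding negligible_nets_iff_locally_negligible by (metis empty_subsetI list.set(1))
  then show "locally_negligible \<Omega> f" by simp
next
  assume f: "locally_negligible \<Omega> f"
  have "locally_negligible \<Omega> (\<lambda>\<epsilon>. partials vs (f \<epsilon>))" if "set vs \<subseteq> Basis" for vs
    using that
  proof (induction vs)
    case (Cons v vs)
    then show ?case
      using locally_negligible_partial[OF assms(1) moderate_partials[OF assms(2)], of vs v] by simp
  qed (simp add: f)
  then show "f \<in> negligible_nets \<Omega>"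
    using assms(2) by (simp add: negligible_nets_iff_locally_negligible moderate_iff_locally_moderate)
qed

section \<open>Operations on moderate nets\<close>

lemma moderate_locally_moderate: "f \<in> moderate \<Omega> \<Longrightarrow> locally_moderate \<Omega> f"
  using moderate_order_locally_moderate[OF moderate_imp_moderate_order] .

lemma moderate_smooth: "f \<in> moderate \<Omega> \<Longrightarrow> \<epsilon> \<in> {0<..1} \<Longrightarrow> smooth_on \<Omega> (f \<epsilon>)"
  by (simp add: moderate_def smooth_nets_def)

text \<open>A fixed smooth function has bounded derivatives on compact sets. Through this equivalence the
  closure properties of moderate nets become closure properties of smooth functions.\<close>

lemma moderate_const_net_iff: "(\<lambda>\<epsilon>. f) \<in> moderate \<Omega> \<longleftrightarrow> smooth_on \<Omega> f"
proof
  show "(\<lambda>\<epsilon>. f) \<in> moderate \<Omega> \<Longrightarrow> smooth_on \<Omega> f"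
    using moderate_smooth[of "\<lambda>\<epsilon>. f" \<Omega> 1] by simp
  show "smooth_on \<Omega> f \<Longrightarrow> (\<lambda>\<epsilon>. f) \<in> moderate \<Omega>"
    unfolding moderate_iff_locally_moderate
    by (auto simp: smooth_nets_def intro!: locally_moderate_const_continuous smooth_on_continuous smooth_on_partials)
qed

lemma moderate_cong:
  assumes "open \<Omega>"
    and "f \<in> moderate \<Omega>"
    and "\<And>\<epsilon> x. \<epsilon> \<in> {0<..1} \<Longrightarrow> x \<in> \<Omega> \<Longrightarrow> f \<epsilon> x = g \<epsilon> x"
  shows "g \<in> moderate \<Omega>"
  by (rule moderate_order_imp_moderate)
    (rule moderate_order_cong[OF assms(1) moderate_imp_moderate_order[OF assms(2)] assms(3)])

lemma moderate_linear:
  assumes "open \<Omega>" "bounded_linear L" "f \<in> moderate \<Omega>"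
  shows "(\<lambda>\<epsilon> x. L (f \<epsilon> x)) \<in> moderate \<Omega>"
  using moderate_order_linear[OF assms(1,2) moderate_imp_moderate_order[OF assms(3)]]
  by (rule moderate_order_imp_moderate)

lemma moderate_add:
  assumes "open \<Omega>" "f \<in> moderate \<Omega>" "g \<in> moderate \<Omega>"
  shows "(\<lambda>\<epsilon> x. f \<epsilon> x + g \<epsilon> x) \<in> moderate \<Omega>"
  using moderate_order_add[OF assms(1) moderate_imp_moderate_order[OF assms(2)]
     moderate_imp_moderate_order[OF assms(3)]]
  by (rule moderate_order_imp_moderate)

lemma moderate_diff:
  assumes "open \<Omega>" "f \<in> moderate \<Omega>" "g \<in> moderate \<Omega>"
  shows "(\<lambda>\<epsilon> x. f \<epsilon> x - g \<epsilon> x) \<in> moderate \<Omega>"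
  using moderate_add[OF assms(1,2) moderate_linear[OF assms(1) bounded_linear_minus[OF bounded_linear_ident] assms(3)]]
  by simp

lemma moderate_sum:
  assumes "open \<Omega>" "finite A" "\<And>i. i \<in> A \<Longrightarrow> f i \<in> moderate \<Omega>"
  shows "(\<lambda>\<epsilon> x. \<Sum>i\<in>A. f i \<epsilon> x) \<in> moderate \<Omega>"
  by (rule moderate_order_imp_moderate, rule moderate_order_sum[OF assms(1,2)])
     (rule moderate_imp_moderate_order[OF assms(3)])

lemma moderate_bilinear:
  assumes "open \<Omega>" "bounded_bilinear B" "f \<in> moderate \<Omega>" "g \<in> moderate \<Omega>"
  shows "(\<lambda>\<epsilon> x. B (f \<epsilon> x) (g \<epsilon> x)) \<in> moderate \<Omega>"
  using moderate_order_bilinear[OF assms(1,2) moderate_imp_moderate_order[OF assms(3)]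
     moderate_imp_moderate_order[OF assms(4)]]
  by (rule moderate_order_imp_moderate)

lemma moderate_const:
  assumes "open \<Omega>" "moderate_bound UNIV (\<lambda>\<epsilon> x::'a::euclidean_space. c \<epsilon>)"
  shows "(\<lambda>\<epsilon> x. c \<epsilon>) \<in> moderate (\<Omega>::'a set)"
  using moderate_order_const[OF assms] by (rule moderate_order_imp_moderate)

lemma moderate_power:
  fixes f :: "('a::euclidean_space, real) net"
  assumes "open \<Omega>" "f \<in> moderate \<Omega>"
  shows "(\<lambda>\<epsilon> x. f \<epsilon> x ^ n) \<in> moderate \<Omega>"
proof (induction n)
  case 0
  show ?case using moderate_const[OF assms(1) moderate_bound_const, of "1::real"] by simp
next
  case (Suc n)
  then show ?case using moderate_bilinear[OF assms(1) bounded_bilinear_mult assms(2) Suc] by simp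
qed

lemma moderate_prod:
  fixes f :: "'i \<Rightarrow> ('a::euclidean_space, real) net"
  assumes "open \<Omega>" "finite A" "\<And>i. i \<in> A \<Longrightarrow> f i \<in> moderate \<Omega>"
  shows "(\<lambda>\<epsilon> x. \<Prod>i\<in>A. f i \<epsilon> x) \<in> moderate \<Omega>"
  using assms(2,3)
proof (induction A)
  case empty
  show ?case using moderate_const[OF assms(1) moderate_bound_const, of "1::real"] by simp
next
  case (insert i A)
  have "(\<lambda>\<epsilon> x. f i \<epsilon> x * (\<Prod>i\<in>A. f i \<epsilon> x)) \<in> moderate \<Omega>"
    by (rule moderate_bilinear[OF assms(1) bounded_bilinear_mult]) (use insert in auto)
  then show ?case using insert.hyps by simp
qed

lemma moderate_ident: "open \<Omega> \<Longrightarrow> (\<lambda>\<epsilon> x. x) \<in> moderate \<Omega>"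
  by (rule moderate_order_imp_moderate) (rule moderate_order_ident)

lemma moderate_Pair:
  fixes f :: "('a::euclidean_space, 'b::real_normed_vector) net"
    and g :: "('a, 'c::real_normed_vector) net"
  assumes "open \<Omega>" "f \<in> moderate \<Omega>" "g \<in> moderate \<Omega>"
  shows "(\<lambda>\<epsilon> x. (f \<epsilon> x, g \<epsilon> x)) \<in> moderate \<Omega>"
proof -
  have "bounded_linear (\<lambda>y. (y, 0::'c))" "bounded_linear (\<lambda>z. (0::'b, z))"
    by (intro bounded_linear_Pair bounded_linear_ident bounded_linear_zero)+
  from moderate_add[OF assms(1) moderate_linear[OF assms(1) this(1) assms(2)]
      moderate_linear[OF assms(1) this(2) assms(3)]]
  show ?thesis by simp
qed

lemma moderate_compose:
  fixes F :: "('a::euclidean_space, 'b::real_normed_vector) net"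
    and \<phi> :: "('c::euclidean_space, 'a) net"
  assumes "open \<Omega>"
    and "\<And>\<epsilon> x. \<epsilon> \<in> {0<..1} \<Longrightarrow> x \<in> \<Omega> \<Longrightarrow> \<phi> \<epsilon> x \<in> S"
    and "\<phi> \<in> moderate \<Omega>"
    and "\<And>\<epsilon>. \<epsilon> \<in> {0<..1} \<Longrightarrow> smooth_on S (F \<epsilon>)" "open S"
    and "\<And>vs. set vs \<subseteq> Basis \<Longrightarrow> locally_moderate \<Omega> (\<lambda>\<epsilon> x. partials vs (F \<epsilon>) (\<phi> \<epsilon> x))"
  shows "(\<lambda>\<epsilon> x. F \<epsilon> (\<phi> \<epsilon> x)) \<in> moderate \<Omega>"
  by (rule moderate_order_imp_moderate)
    (rule moderate_order_compose[OF assms(1,2) moderate_imp_moderate_order[OF assms(3)] assms(4-6)])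

lemma moderate_compose_smooth:
  assumes "open \<Omega>" "open S" "u \<in> moderate S" "smooth_on \<Omega> \<psi>" "\<psi> ` \<Omega> \<subseteq> S"
  shows "(\<lambda>\<epsilon> x. u \<epsilon> (\<psi> x)) \<in> moderate \<Omega>"
proof (rule moderate_compose[where S = S and F = u and \<phi> = "\<lambda>\<epsilon>. \<psi>"])
  show "(\<lambda>\<epsilon>. \<psi>) \<in> moderate \<Omega>" using assms(4) by (simp add: moderate_const_net_iff)
  show "locally_moderate \<Omega> (\<lambda>\<epsilon> x. partials vs (u \<epsilon>) (\<psi> x))" if "set vs \<subseteq> Basis" for vs
    using moderate_locally_moderate[OF moderate_partials[OF assms(3) that]]
      smooth_on_continuous[OF assms(4)] assms(5)
    by (rule locally_moderate_compose_continuous)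
  show "smooth_on S (u \<epsilon>)" if "\<epsilon> \<in> {0<..1}" for \<epsilon>
    using assms(3) that by (rule moderate_smooth)
qed (use assms in auto)

lemma smooth_on_compose:
  assumes "open \<Omega>" "open S" "smooth_on S f" "smooth_on \<Omega> \<psi>" "\<psi> ` \<Omega> \<subseteq> S"
  shows "smooth_on \<Omega> (\<lambda>x. f (\<psi> x))"
  using moderate_compose_smooth[OF assms(1,2) _ assms(4,5), of "\<lambda>\<epsilon>. f"] assms(3)
  by (simp add: moderate_const_net_iff)

lemma smooth_on_linear:
  assumes "open S" "bounded_linear L" "smooth_on S f"
  shows "smooth_on S (\<lambda>x. L (f x))"
  using moderate_linear[OF assms(1,2), of "\<lambda>\<epsilon>. f"] assms(3) by (simp add: moderate_const_net_iff)

lemma smooth_on_const: "open S \<Longrightarrow> smooth_on S (\<lambda>x. c)"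
  using moderate_const[OF _ moderate_bound_const, of S c] moderate_const_net_iff[of "\<lambda>x. c" S] by blast

lemma smooth_on_ident: "open S \<Longrightarrow> smooth_on S (\<lambda>x. x)"
  using moderate_ident[of S] moderate_const_net_iff[of "\<lambda>x. x" S] by blast

lemma smooth_on_Pair:
  assumes "open S" "smooth_on S f" "smooth_on S g"
  shows "smooth_on S (\<lambda>x. (f x, g x))"
  using moderate_Pair[OF assms(1), of "\<lambda>\<epsilon>. f" "\<lambda>\<epsilon>. g"] assms(2,3) by (simp add: moderate_const_net_iff)

section \<open>Functions of polynomial growth along fibres\<close>

text \<open>The growth condition shared by \<open>\<Delta>\<close> (with the derivatives of \<open>u\<close> as the fibre variable) and by the fibre
  component of a slowly increasing transformation, over a region whose fibres are whole spaces.\<close>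

definition fibrewise_tempered ::
    "'a::euclidean_space set \<Rightarrow> ('a \<times> 'b::euclidean_space \<Rightarrow> 'c::real_normed_vector) \<Rightarrow> bool" where
  "fibrewise_tempered \<Omega> F \<longleftrightarrow> smooth_on (\<Omega> \<times> UNIV) F \<and>
     (\<forall>K vs. compact K \<longrightarrow> K \<subseteq> \<Omega> \<longrightarrow> set vs \<subseteq> Basis \<longrightarrow>
        (\<exists>C m. \<forall>x\<in>K. \<forall>u. norm (partials vs F (x, u)) \<le> C * (1 + norm u) ^ m))"

lemma locally_moderate_tempered_partials:
  assumes "fibrewise_tempered \<Omega> F" "locally_moderate \<Omega> u" "set vs \<subseteq> Basis"
  shows "locally_moderate \<Omega> (\<lambda>\<epsilon> x. partials vs F (x, u \<epsilon> x))"
  unfolding locally_moderate_def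
proof (intro allI impI)
  fix K assume K: "compact K" "K \<subseteq> \<Omega>"
  obtain C m where C: "\<And>x u. x \<in> K \<Longrightarrow> norm (partials vs F (x, u)) \<le> C * (1 + norm u) ^ m"
    using assms(1)[unfolded fibrewise_tempered_def, THEN conjunct2, rule_format, OF K assms(3)]
    by metis
  have "moderate_bound K u" using assms(2) K unfolding locally_moderate_def by blast
  then have "moderate_bound K (\<lambda>\<epsilon> x. norm (u \<epsilon> x))" by (simp add: moderate_bound_norm_iff)
  from moderate_bound_one_plus_power[OF this, of C m]
  show "moderate_bound K (\<lambda>\<epsilon> x. partials vs F (x, u \<epsilon> x))"
    by (rule moderate_bound_dominated) (unfold real_norm_def, rule order_trans[OF C abs_ge_self])
qed

lemma moderate_tempered_compose:
  fixes F :: "'a::euclidean_space \<times> 'b::euclidean_space \<Rightarrow> 'c::real_normed_vector"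
  assumes "open \<Omega>" "fibrewise_tempered \<Omega> F" "u \<in> moderate \<Omega>"
  shows "(\<lambda>\<epsilon> x. F (x, u \<epsilon> x)) \<in> moderate \<Omega>"
proof (rule moderate_compose[where S = "\<Omega> \<times> UNIV" and F = "\<lambda>\<epsilon>. F" and \<phi> = "\<lambda>\<epsilon> x. (x, u \<epsilon> x)"])
  show "(\<lambda>\<epsilon> x. (x, u \<epsilon> x)) \<in> moderate \<Omega>"
    by (rule moderate_Pair[OF assms(1) moderate_ident[OF assms(1)] assms(3)])
  show "locally_moderate \<Omega> (\<lambda>\<epsilon> x. partials vs F (x, u \<epsilon> x))" if "set vs \<subseteq> Basis" for vs
    using assms(2) moderate_locally_moderate[OF assms(3)] that by (rule locally_moderate_tempered_partials)
qed (use assms in \<open>auto simp: fibrewise_tempered_def open_Times\<close>)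

text \<open>Only the fibre variable moves, along a segment; this stays in the domain since the fibres are
  whole spaces.\<close>

lemma mean_value_fibre:
  fixes F :: "'a::euclidean_space \<times> 'b::euclidean_space \<Rightarrow> 'c::real_normed_vector"
  assumes "smooth_on (\<Omega> \<times> UNIV) F" "x \<in> \<Omega>"
    and B: "\<And>b z. b \<in> Basis \<Longrightarrow> z \<in> closed_segment u w \<Longrightarrow>
      norm (frechet_derivative F (at (x, z)) b) \<le> B b"
  shows "norm (F (x, u) - F (x, w)) \<le> (\<Sum>b\<in>Basis. B b) * norm (u - w)"
proof (rule differentiable_bound[of "closed_segment u w" "\<lambda>z. F (x, z)"
      "\<lambda>z k. frechet_derivative F (at (x, z)) (0, k)"])
  fix z assume z: "z \<in> closed_segment u w"
  have d: "F differentiable (at (x, z))"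
    using assms(1,2) by (auto intro: smooth_on_differentiable)
  have "((\<lambda>z. (x, z)) has_derivative (\<lambda>k. (0, k))) (at z within closed_segment u w)"
    by (auto intro!: derivative_eq_intros)
  from has_derivative_compose[OF this d[unfolded frechet_derivative_works]]
  show "((\<lambda>z. F (x, z)) has_derivative (\<lambda>k. frechet_derivative F (at (x, z)) (0, k)))
      (at z within closed_segment u w)" .
  show "onorm (\<lambda>k. frechet_derivative F (at (x, z)) (0, k)) \<le> (\<Sum>b\<in>Basis. B b)"
  proof (rule onorm_le)
    fix k :: 'b
    have "norm (frechet_derivative F (at (x, z)) (0, k))
        \<le> (\<Sum>b\<in>Basis. norm (((0::'a, k) \<bullet> b) *\<^sub>R frechet_derivative F (at (x, z)) b))"
      unfolding frechet_derivative_basis_expansion[OF d, of "(0, k)"] by (rule norm_sum)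
    also have "\<dots> \<le> (\<Sum>b\<in>Basis. norm k * B b)"
    proof (rule sum_mono)
      fix b :: "'a \<times> 'b" assume b: "b \<in> Basis"
      have "\<bar>(0::'a, k) \<bullet> b\<bar> \<le> norm (0::'a, k)" using b by (rule Basis_le_norm)
      then have "\<bar>(0::'a, k) \<bullet> b\<bar> * norm (frechet_derivative F (at (x, z)) b) \<le> norm k * B b"
        using B[OF b z] by (intro mult_mono) auto
      then show "norm (((0::'a, k) \<bullet> b) *\<^sub>R frechet_derivative F (at (x, z)) b) \<le> norm k * B b"
        by simp
    qed
    finally show "norm (frechet_derivative F (at (x, z)) (0, k)) \<le> (\<Sum>b\<in>Basis. B b) * norm k"
      by (simp add: sum_distrib_left mult.commute)
  qed
qed auto

lemma norm_on_closed_segment: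
  fixes u w :: "'a::real_normed_vector"
  assumes "z \<in> closed_segment u w"
  shows "norm z \<le> norm u + norm w"
proof -
  obtain t where t: "0 \<le> t" "t \<le> 1" "z = (1 - t) *\<^sub>R u + t *\<^sub>R w"
    using assms by (auto simp: closed_segment_def)
  have "norm z \<le> (1 - t) * norm u + t * norm w"
    using norm_triangle_ineq[of "(1 - t) *\<^sub>R u" "t *\<^sub>R w"] t by simp
  also have "\<dots> \<le> 1 * norm u + 1 * norm w"
    using t by (intro add_mono mult_right_mono) auto
  finally show ?thesis by simp
qed

text \<open>The Lipschitz constant on the segment between \<open>u \<epsilon> x\<close> and \<open>w \<epsilon> x\<close> is at most a polynomial in the
  norms of its end points, hence moderate, and the product of a moderate and a negligible net is
  negligible.\<close>

lemma locally_negligible_tempered_diff: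
  fixes F :: "'a::euclidean_space \<times> 'b::euclidean_space \<Rightarrow> 'c::real_normed_vector"
  assumes "fibrewise_tempered \<Omega> F" "locally_moderate \<Omega> u" "locally_moderate \<Omega> w"
    and "locally_negligible \<Omega> (\<lambda>\<epsilon> x. u \<epsilon> x - w \<epsilon> x)"
  shows "locally_negligible \<Omega> (\<lambda>\<epsilon> x. F (x, u \<epsilon> x) - F (x, w \<epsilon> x))"
  unfolding locally_negligible_def
proof (intro allI impI)
  fix K assume K: "compact K" "K \<subseteq> \<Omega>"
  have F: "smooth_on (\<Omega> \<times> UNIV) F" using assms(1) by (simp add: fibrewise_tempered_def)
  have "\<exists>C m. \<forall>x\<in>K. \<forall>u. norm (frechet_derivative F (at (x, u)) b) \<le> C * (1 + norm u) ^ m"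
    if "b \<in> Basis" for b
    using assms(1)[unfolded fibrewise_tempered_def, THEN conjunct2, rule_format, of K "[b]"] K that
    by simp
  then obtain C m where C: "\<And>b x u. b \<in> Basis \<Longrightarrow> x \<in> K \<Longrightarrow>
      norm (frechet_derivative F (at (x, u)) b) \<le> C b * (1 + norm u) ^ m b"
    by metis
  define B where "B b r = \<bar>C b\<bar> * (1 + r) ^ m b" for b and r :: real
  have "moderate_bound K (\<lambda>\<epsilon> x. norm (u \<epsilon> x))" "moderate_bound K (\<lambda>\<epsilon> x. norm (w \<epsilon> x))"
    using assms(2,3) K by (simp_all add: moderate_bound_norm_iff locally_moderate_def)
  then have uw: "moderate_bound K (\<lambda>\<epsilon> x. norm (u \<epsilon> x) + norm (w \<epsilon> x))"
    by (rule moderate_bound_add)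
  have 1: "moderate_bound K (\<lambda>\<epsilon> x. \<Sum>b\<in>Basis. B b (norm (u \<epsilon> x) + norm (w \<epsilon> x)))"
    unfolding B_def by (intro moderate_bound_sum finite_Basis moderate_bound_one_plus_power uw)
  have 2: "negligible_bound K (\<lambda>\<epsilon> x. norm (u \<epsilon> x - w \<epsilon> x))"
    using assms(4) K by (simp add: negligible_bound_norm_iff locally_negligible_def)
  show "negligible_bound K (\<lambda>\<epsilon> x. F (x, u \<epsilon> x) - F (x, w \<epsilon> x))"
  proof (rule negligible_bound_dominated[OF negligible_bound_mult[OF 1 2]])
    fix \<epsilon> x assume x: "x \<in> K"
    have "norm (F (x, u \<epsilon> x) - F (x, w \<epsilon> x))
      \<le> (\<Sum>b\<in>Basis. B b (norm (u \<epsilon> x) + norm (w \<epsilon> x))) * norm (u \<epsilon> x - w \<epsilon> x)"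
    proof (rule mean_value_fibre[OF F])
      show "x \<in> \<Omega>" using x K by blast
      fix b :: "'a \<times> 'b" and z assume bz: "b \<in> Basis" "z \<in> closed_segment (u \<epsilon> x) (w \<epsilon> x)"
      have "C b * (1 + norm z) ^ m b \<le> \<bar>C b\<bar> * (1 + (norm (u \<epsilon> x) + norm (w \<epsilon> x))) ^ m b"
        using norm_on_closed_segment[OF bz(2)] by (intro mult_mono power_mono) auto
      with C[OF bz(1) x, of z] show "norm (frechet_derivative F (at (x, z)) b) \<le> B b (norm (u \<epsilon> x) + norm (w \<epsilon> x))"
        unfolding B_def by linarith
    qed
    then show "norm (F (x, u \<epsilon> x) - F (x, w \<epsilon> x))
      \<le> norm ((\<Sum>b\<in>Basis. B b (norm (u \<epsilon> x) + norm (w \<epsilon> x))) * norm (u \<epsilon> x - w \<epsilon> x))"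
      unfolding real_norm_def by (rule order_trans[OF _ abs_ge_self])
  qed
qed

section \<open>Jets of nets\<close>

lemma partials_add_scaleR:
  fixes f g :: "'a::euclidean_space \<Rightarrow> 'b::real_normed_vector"
  assumes "open S" "smooth_on S f" "smooth_on S g" "set vs \<subseteq> Basis" "x \<in> S"
  shows "partials vs (\<lambda>x. f x + c *\<^sub>R g x) x = partials vs f x + c *\<^sub>R partials vs g x"
  using assms(4,5)
proof (induction vs arbitrary: x)
  case (Cons v vs)
  have f: "partials vs f differentiable (at x)" and g: "partials vs g differentiable (at x)"
    using Cons.prems smooth_on_partials[OF assms(2), of vs] smooth_on_partials[OF assms(3), of vs]
    by (auto intro: smooth_on_differentiable)
  have "((\<lambda>x. partials vs f x + c *\<^sub>R partials vs g x) has_derivative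
     (\<lambda>h. frechet_derivative (partials vs f) (at x) h + c *\<^sub>R frechet_derivative (partials vs g) (at x) h)) (at x)"
    using f g unfolding frechet_derivative_works
    by (intro has_derivative_add has_derivative_scaleR_right)
  moreover have "frechet_derivative (partials vs (\<lambda>x. f x + c *\<^sub>R g x)) (at x)
    = frechet_derivative (\<lambda>x. partials vs f x + c *\<^sub>R partials vs g x) (at x)"
    using Cons by (intro frechet_derivative_cong_open[OF assms(1)]) auto
  ultimately show ?case by (simp add: frechet_derivative_eqI)
qed simp

text \<open>The choice made inside \<^const>\<open>mderiv\<close>, named so that it can be reasoned about.\<close>

definition multi_index_path :: "('p::finite \<Rightarrow> nat) \<Rightarrow> 'p list" where
  "multi_index_path \<alpha> = (SOME is. \<forall>i. count_list is i = \<alpha> i)"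

text \<open>On a finite index type every function to the naturals is the count of a multiset, hence of a list,
  so the choice is not vacuous.\<close>

lemma count_multi_index_path: "count_list (multi_index_path \<alpha>) i = \<alpha> i"
proof -
  obtain xs where xs: "mset xs = Abs_multiset \<alpha>" using ex_mset by blast
  have "count (Abs_multiset \<alpha>) = \<alpha>" by (rule Abs_multiset_inverse) simp
  with xs have "\<forall>i. count_list xs i = \<alpha> i" by (metis count_mset)
  then have "\<forall>i. count_list (multi_index_path \<alpha>) i = \<alpha> i"
    unfolding multi_index_path_def by (rule someI)
  then show ?thesis by blast
qed

lemma mderiv_eq_partials:
  "mderiv \<alpha> f = partials (map (\<lambda>i. axis i 1) (multi_index_path \<alpha>)) f"
  by (simp add: mderiv_def multi_index_path_def)

lemma axis_path_subset_Basis: "set (map (\<lambda>i. axis i (1::real)) is) \<subseteq> Basis"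
  by auto

abbreviation jet_part ::
    "(real^'p \<Rightarrow> real^'q) \<Rightarrow> real^'p \<Rightarrow> (real^'q)^(('p::finite, 'n::len0) multi_index)" where
  "jet_part u x \<equiv> (\<chi> \<alpha>. mderiv (Rep_multi_index \<alpha>) u x)"

lemma vec_lambda_sum_axis: "(\<chi> i. f i) = (\<Sum>i\<in>UNIV. axis i (f i))"
  for f :: "'i::finite \<Rightarrow> 'b::real_normed_vector"
  by (simp add: vec_eq_iff axis_def sum.delta)

lemma bounded_linear_axis: "bounded_linear (axis i :: 'b::euclidean_space \<Rightarrow> 'b^'i::finite)"
  by (rule linear_conv_bounded_linear[THEN iffD1], rule linearI) (auto simp: vec_eq_iff axis_def)

lemma moderate_jet_part:
  fixes u :: "(real^'p, real^'q) net"
  assumes "open \<Omega>" "u \<in> moderate \<Omega>"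
  shows "(\<lambda>\<epsilon> x. jet_part (u \<epsilon>) x :: (real^'q)^(('p::finite, 'n::len0) multi_index)) \<in> moderate \<Omega>"
  unfolding vec_lambda_sum_axis mderiv_eq_partials
  by (intro moderate_sum[OF assms(1)] finite moderate_linear[OF assms(1) bounded_linear_axis])
    (rule moderate_partials[OF assms(2) axis_path_subset_Basis])

lemma jet_part_add_scaleR:
  fixes u w :: "real^'p \<Rightarrow> real^'q"
  assumes "open \<Omega>" "smooth_on \<Omega> u" "smooth_on \<Omega> w" "x \<in> \<Omega>"
  shows "(jet_part (\<lambda>x. u x + c *\<^sub>R w x) x :: (real^'q)^(('p::finite, 'n::len0) multi_index))
     = jet_part u x + c *\<^sub>R jet_part w x"
  using partials_add_scaleR[OF assms(1-3) axis_path_subset_Basis assms(4)]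
  by (simp add: vec_eq_iff mderiv_eq_partials)

text \<open>The jet contains derivatives, but those of a negligible net are negligible, and differentiation
  is linear.\<close>

lemma locally_negligible_jet_part_diff:
  fixes u w :: "(real^'p, real^'q) net"
  assumes "open \<Omega>" "u \<in> moderate \<Omega>" "w \<in> moderate \<Omega>"
    and "locally_negligible \<Omega> (\<lambda>\<epsilon> x. u \<epsilon> x - w \<epsilon> x)"
  shows "locally_negligible \<Omega>
     (\<lambda>\<epsilon> x. jet_part (u \<epsilon>) x - jet_part (w \<epsilon>) x :: (real^'q)^(('p::finite, 'n::len0) multi_index))"
proof -
  have "(\<lambda>\<epsilon> x. u \<epsilon> x - w \<epsilon> x) \<in> negligible_nets \<Omega>"
    using negligible_iff_locally_negligible[OF assms(1) moderate_diff[OF assms(1-3)]] assms(4) by simp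
  then have "locally_negligible \<Omega> (\<lambda>\<epsilon>. partials (map (\<lambda>i. axis i 1) is) (\<lambda>x. u \<epsilon> x - w \<epsilon> x))" for "is"
    using axis_path_subset_Basis[of "is"] unfolding negligible_nets_iff_locally_negligible by blast
  then have "locally_negligible \<Omega>
     (\<lambda>\<epsilon> x. jet_part (\<lambda>x. u \<epsilon> x - w \<epsilon> x) x :: (real^'q)^(('p::finite, 'n::len0) multi_index))"
    unfolding vec_lambda_sum_axis mderiv_eq_partials
    by (intro locally_negligible_sum finite locally_negligible_linear[OF bounded_linear_axis])
  then show ?thesis
  proof (rule locally_negligible_dominated)
    fix \<epsilon> :: real and x assume "\<epsilon> \<in> {0<..1}" "x \<in> \<Omega>"
    then show "norm (jet_part (u \<epsilon>) x - jet_part (w \<epsilon>) x :: (real^'q)^(('p, 'n) multi_index))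
       \<le> norm (jet_part (\<lambda>x. u \<epsilon> x - w \<epsilon> x) x :: (real^'q)^(('p, 'n) multi_index))"
      using jet_part_add_scaleR[OF assms(1) moderate_smooth[OF assms(2)] moderate_smooth[OF assms(3)],
          of \<epsilon> \<epsilon> x "-1", where 'n = 'n] by simp
  qed
qed

section \<open>Monomials prescribing one jet coordinate\<close>

text \<open>The monomial \<open>y\<^sup>\<gamma> / \<gamma>!\<close>. Thanks to the factorials, differentiation lowers an exponent without
  producing a factor.\<close>

definition divided_power :: "('p::finite \<Rightarrow> nat) \<Rightarrow> real^'p \<Rightarrow> real" where
  "divided_power \<gamma> y = (\<Prod>i\<in>UNIV. (y $ i) ^ \<gamma> i / fact (\<gamma> i))"

lemma divided_power_at_zero: "divided_power \<gamma> 0 = (if \<gamma> = (\<lambda>_. 0) then 1 else 0)"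
proof (cases "\<gamma> = (\<lambda>_. 0)")
  case False
  then obtain i where "\<gamma> i \<noteq> 0" by auto
  then have "(\<Prod>i\<in>UNIV. (0::real) ^ \<gamma> i / fact (\<gamma> i)) = 0"
    by (intro prod_zero) (auto intro!: bexI[of _ i])
  then show ?thesis using False by (simp add: divided_power_def)
qed (simp add: divided_power_def)

lemma frechet_derivative_divided_power:
  fixes e :: "'b::real_normed_vector"
  shows "frechet_derivative (\<lambda>y. divided_power \<gamma> (y - x0) *\<^sub>R e) (at y) (axis j 1)
    = (if \<gamma> j = 0 then 0 else divided_power (\<gamma>(j := \<gamma> j - 1)) (y - x0) *\<^sub>R e)"
proof -
  define f where "f i y = ((y - x0) $ i) ^ \<gamma> i / fact (\<gamma> i)" for i y
  define f' where "f' i h = real (\<gamma> i) * ((y - x0) $ i) ^ (\<gamma> i - 1) / fact (\<gamma> i) * h $ i" for i h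
  have "(f i has_derivative f' i) (at y)" for i
    unfolding f_def f'_def
    by (auto intro!: derivative_eq_intros bounded_linear.has_derivative[OF bounded_linear_vec_nth])
  then have "((\<lambda>y. \<Prod>i\<in>UNIV. f i y) has_derivative (\<lambda>h. \<Sum>i\<in>UNIV. f' i h * (\<Prod>l\<in>UNIV - {i}. f l y))) (at y)"
    by (intro has_derivative_prod)
  then have "((\<lambda>y. divided_power \<gamma> (y - x0) *\<^sub>R e) has_derivative
      (\<lambda>h. (\<Sum>i\<in>UNIV. f' i h * (\<Prod>l\<in>UNIV - {i}. f l y)) *\<^sub>R e)) (at y)"
    unfolding divided_power_def f_def by (intro has_derivative_scaleR_left)
  from frechet_derivative_eqI[OF this]
  have "frechet_derivative (\<lambda>y. divided_power \<gamma> (y - x0) *\<^sub>R e) (at y) (axis j 1)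
    = (\<Sum>i\<in>UNIV. f' i (axis j 1) * (\<Prod>l\<in>UNIV - {i}. f l y)) *\<^sub>R e" by simp
  also have "(\<Sum>i\<in>UNIV. f' i (axis j 1) * (\<Prod>l\<in>UNIV - {i}. f l y))
     = (\<Sum>i\<in>UNIV. if i = j then f' j (axis j 1) * (\<Prod>l\<in>UNIV - {j}. f l y) else 0)"
    by (rule sum.cong) (auto simp: f'_def axis_def)
  also have "\<dots> = f' j (axis j 1) * (\<Prod>l\<in>UNIV - {j}. f l y)"
    by simp
  also have "\<dots> = (if \<gamma> j = 0 then 0 else divided_power (\<gamma>(j := \<gamma> j - 1)) (y - x0))"
  proof (cases "\<gamma> j")
    case (Suc n)
    have "divided_power (\<gamma>(j := n)) (y - x0) = ((y - x0) $ j) ^ n / fact n * (\<Prod>l\<in>UNIV - {j}. f l y)"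
      unfolding divided_power_def by (subst prod.remove[of _ j]) (auto simp: f_def)
    moreover have "f' j (axis j 1) = ((y - x0) $ j) ^ n / fact n"
      using Suc by (simp add: f'_def)
    ultimately show ?thesis using Suc by simp
  qed (simp add: f'_def)
  finally show ?thesis by simp
qed

lemma partials_divided_power:
  fixes e :: "'b::real_normed_vector"
  shows "partials (map (\<lambda>i. axis i 1) is) (\<lambda>y. divided_power \<gamma> (y - x0) *\<^sub>R e)
    = (\<lambda>y. if \<forall>i. count_list is i \<le> \<gamma> i
           then divided_power (\<lambda>i. \<gamma> i - count_list is i) (y - x0) *\<^sub>R e else 0)"
proof (induction "is")
  case (Cons j js)
  let ?\<delta> = "\<lambda>i. \<gamma> i - count_list js i"
  show ?case
  proof (cases "\<forall>i. count_list js i \<le> \<gamma> i")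
    case True
    have 1: "(\<forall>i. count_list (j # js) i \<le> \<gamma> i) \<longleftrightarrow> ?\<delta> j \<noteq> 0"
      using True by (auto simp: Suc_le_eq)
    have 2: "(\<lambda>i. \<gamma> i - count_list (j # js) i) = ?\<delta>(j := ?\<delta> j - 1)"
      by auto
    have "partials (map (\<lambda>i. axis i 1) (j # js)) (\<lambda>y. divided_power \<gamma> (y - x0) *\<^sub>R e)
      = (\<lambda>y. frechet_derivative (\<lambda>y. divided_power ?\<delta> (y - x0) *\<^sub>R e) (at y) (axis j 1))"
      using True Cons.IH by simp
    also have "\<dots> = (\<lambda>y. if ?\<delta> j = 0 then 0 else divided_power (?\<delta>(j := ?\<delta> j - 1)) (y - x0) *\<^sub>R e)"
      by (simp only: frechet_derivative_divided_power)
    finally show ?thesis unfolding 1 2 by (rule trans) (rule ext, simp)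
  next
    case False
    then obtain i where i: "\<gamma> i < count_list js i" by (auto simp: not_le)
    then have "\<gamma> i < count_list (j # js) i" by simp
    then have 1: "(\<forall>i. count_list (j # js) i \<le> \<gamma> i) \<longleftrightarrow> False"
      unfolding not_le[symmetric] by blast
    have "partials (map (\<lambda>i. axis i 1) js) (\<lambda>y. divided_power \<gamma> (y - x0) *\<^sub>R e) = (\<lambda>_. 0)"
      unfolding Cons.IH using False by (intro ext if_not_P)
    then show ?thesis unfolding 1 by simp
  qed
qed simp

lemma mderiv_divided_power:
  fixes e :: "'b::real_normed_vector"
  shows "mderiv \<beta> (\<lambda>y. divided_power \<gamma> (y - x0) *\<^sub>R e) x0 = (if \<beta> = \<gamma> then e else 0)"
proof -
  have "(\<forall>i. \<beta> i \<le> \<gamma> i) \<and> (\<lambda>i. \<gamma> i - \<beta> i) = (\<lambda>_. 0) \<longleftrightarrow> \<beta> = \<gamma>"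
    by (auto simp: fun_eq_iff intro: le_antisym)
  then show ?thesis
    by (auto simp: mderiv_eq_partials partials_divided_power count_multi_index_path divided_power_at_zero)
qed

lemma jet_part_divided_power:
  "(jet_part (\<lambda>y. divided_power (Rep_multi_index \<alpha>) (y - x0) *\<^sub>R e) x0
     :: (real^'q)^(('p::finite, 'n::len0) multi_index)) = axis \<alpha> e"
  by (simp add: vec_eq_iff mderiv_divided_power axis_def Rep_multi_index_inject)

lemma moderate_divided_power:
  fixes x0 :: "real \<Rightarrow> real^'p::finite"
  assumes "open \<Omega>" "moderate_bound UNIV (\<lambda>\<epsilon> y::real^'p. x0 \<epsilon>)"
  shows "(\<lambda>\<epsilon> y. divided_power \<gamma> (y - x0 \<epsilon>)) \<in> moderate \<Omega>"
proof -
  have 1: "(\<lambda>\<epsilon> y. y - x0 \<epsilon>) \<in> moderate \<Omega>"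
    by (rule moderate_diff[OF assms(1) moderate_ident[OF assms(1)] moderate_const[OF assms]])
  have 2: "(\<lambda>\<epsilon> y. (y - x0 \<epsilon>) $ i) \<in> moderate \<Omega>" for i
    by (rule moderate_linear[OF assms(1) bounded_linear_vec_nth 1])
  have "(\<lambda>\<epsilon> y. ((y - x0 \<epsilon>) $ i) ^ \<gamma> i / fact (\<gamma> i)) \<in> moderate \<Omega>" for i
    by (rule moderate_linear[OF assms(1) bounded_linear_divide moderate_power[OF assms(1) 2]])
  then show ?thesis
    unfolding divided_power_def by (intro moderate_prod[OF assms(1) finite])
qed

section \<open>Slowly increasing diffeomorphisms\<close>

text \<open>Here \<open>h\<close> and \<open>k\<close> stand for \<open>g \<eta>\<close> and \<open>g (- \<eta>)\<close> with their domains \<open>E\<close> and \<open>E'\<close>, and \<open>\<Omega>\<close> for a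
  region over which functions with arbitrary values can be transformed by \<open>h\<close>.\<close>

locale slowly_increasing_diffeo =
  fixes E E' :: "((real^'p::finite) \<times> (real^'q::finite)) set"
    and h k :: "(real^'p) \<times> (real^'q) \<Rightarrow> (real^'p) \<times> (real^'q)"
    and \<Omega> :: "(real^'p) set"
  assumes open_E: "open E" and open_E': "open E'"
    and smooth_h: "smooth_on E h" and smooth_k: "smooth_on E' k"
    and h_in: "m \<in> E \<Longrightarrow> h m \<in> E'" and k_in: "m \<in> E' \<Longrightarrow> k m \<in> E"
    and k_h: "m \<in> E \<Longrightarrow> k (h m) = m" and h_k: "m \<in> E' \<Longrightarrow> h (k m) = m"
    and h_tempered: "slowly_increasing_transformation E h"
    and k_tempered: "slowly_increasing_transformation E' k"
    and open_\<Omega>: "open \<Omega>" and cylinder: "\<Omega> \<times> UNIV \<subseteq> E"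
begin

definition "\<Omega>' = base_map h ` \<Omega>"

lemma fst_h: "x \<in> \<Omega> \<Longrightarrow> fst (h (x, u)) = base_map h x"
proof -
  obtain \<Xi> where \<Xi>: "\<And>x u. (x, u) \<in> E \<Longrightarrow> fst (h (x, u)) = \<Xi> x"
    using h_tempered unfolding slowly_increasing_transformation_def projectable_def by blast
  show ?thesis if "x \<in> \<Omega>"
  proof -
    have "(x, u) \<in> E" "(x, 0) \<in> E" using that cylinder by auto
    then show ?thesis using \<Xi> by (simp add: base_map_def)
  qed
qed

lemma fst_k: "(y, v) \<in> E' \<Longrightarrow> (y, w) \<in> E' \<Longrightarrow> fst (k (y, v)) = fst (k (y, w))"
proof -
  obtain \<Xi> where \<Xi>: "\<And>x u. (x, u) \<in> E' \<Longrightarrow> fst (k (x, u)) = \<Xi> x"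
    using k_tempered unfolding slowly_increasing_transformation_def projectable_def by blast
  show ?thesis if "(y, v) \<in> E'" "(y, w) \<in> E'" using \<Xi> that by simp
qed

lemma h_eq: "x \<in> \<Omega> \<Longrightarrow> h (x, u) = (base_map h x, snd (h (x, u)))"
  using fst_h by (simp add: prod_eq_iff)

text \<open>The part \<open>T\<close> of the fibre over \<open>y\<close> that lies in the domain of \<open>k\<close> is open. It is also closed: the
  growth estimate for \<open>k\<close> keeps the preimages of a convergent sequence in \<open>T\<close> bounded, and \<open>h\<close> maps a
  limit point of the preimages to the limit of the sequence. The estimate for the inverse is
  essential: \<open>u \<mapsto> u + \<surd>(1 + u\<^sup>2)\<close> and its derivatives have polynomial growth, yet it maps the
  line onto a half-line.\<close>

lemma full_fibre:
  assumes x: "x \<in> \<Omega>"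
  shows "(base_map h x, v) \<in> E'"
proof -
  let ?y = "base_map h x"
  have xE: "(x, u) \<in> E" for u using x cylinder by blast
  define T where "T = {v. (?y, v) \<in> E'}"
  have y0: "(?y, snd (h (x, 0))) \<in> E'"
    using h_in[OF xE[of 0]] h_eq[OF x, of 0] by simp
  have fst_ky: "fst (k (?y, v)) = x" if "v \<in> T" for v
  proof -
    have "fst (k (?y, v)) = fst (k (h (x, 0)))"
      using fst_k[OF _ y0] that h_eq[OF x, of 0] by (simp add: T_def)
    then show ?thesis using k_h[OF xE] by simp
  qed
  have "open T"
  proof -
    have "T = Pair ?y -` E'" by (auto simp: T_def)
    then show ?thesis using open_E' by (auto intro!: open_vimage continuous_intros)
  qed
  moreover have "closed T"
    unfolding closed_sequential_limits
  proof (intro allI impI, elim conjE)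
    fix vs v assume vs: "\<forall>n. vs n \<in> T" and lim: "vs \<longlonglongrightarrow> v"
    define us where "us n = snd (k (?y, vs n))" for n
    have h_us: "h (x, us n) = (?y, vs n)" for n
    proof -
      have "k (?y, vs n) = (x, us n)" using fst_ky vs by (simp add: us_def prod_eq_iff)
      then show ?thesis using h_k[of "(?y, vs n)"] vs by (simp add: T_def)
    qed
    have "{?y} \<subseteq> fst ` E'" using y0 by force
    then obtain C m where "\<forall>(y, v)\<in>E'. y \<in> {?y} \<longrightarrow>
        norm (partials [] (\<lambda>z. snd (k z)) (y, v)) \<le> C * (1 + norm v) ^ m"
      using k_tempered[unfolded slowly_increasing_transformation_def, THEN conjunct2, rule_format,
          of "{?y}" "[]"] by auto
    then have C: "norm (us n) \<le> C * (1 + norm (vs n)) ^ m" for n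
      using vs by (auto simp: us_def T_def)
    have "bounded (range vs)" using lim by (simp add: convergent_imp_bounded)
    then obtain R where R: "norm (vs n) \<le> R" for n unfolding bounded_iff by blast
    have "norm (us n) \<le> \<bar>C\<bar> * (1 + R) ^ m" for n
    proof -
      have "C * (1 + norm (vs n)) ^ m \<le> \<bar>C\<bar> * (1 + R) ^ m"
        using R[of n] by (intro mult_mono power_mono) auto
      then show ?thesis using C[of n] by linarith
    qed
    then have "bounded (range us)" unfolding bounded_iff by blast
    then obtain u r where r: "strict_mono (r :: nat \<Rightarrow> nat)" and u: "(us \<circ> r) \<longlonglongrightarrow> u"
      using bounded_imp_convergent_subsequence by blast
    have "isCont h (x, u)"
      using smooth_on_continuous[OF smooth_h] open_E xE continuous_on_eq_continuous_at by blast
    moreover have "(\<lambda>n. (x, us (r n))) \<longlonglongrightarrow> (x, u)"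
      using u by (intro tendsto_Pair tendsto_const) (simp add: o_def)
    ultimately have "(\<lambda>n. h (x, us (r n))) \<longlonglongrightarrow> h (x, u)"
      by (rule isCont_tendsto_compose)
    moreover have "(\<lambda>n. h (x, us (r n))) \<longlonglongrightarrow> (?y, v)"
      using LIMSEQ_subseq_LIMSEQ[OF lim r] unfolding h_us
      by (intro tendsto_Pair tendsto_const) (simp add: o_def)
    ultimately have "h (x, u) = (?y, v)" by (rule LIMSEQ_unique)
    then show "v \<in> T" using h_in[OF xE[of u]] by (simp add: T_def)
  qed
  moreover have "T \<noteq> {}" using y0 by (auto simp: T_def)
  ultimately have "T = UNIV" using clopen[of T] by blast
  then show ?thesis by (auto simp: T_def)
qed

lemma image_cylinder: "\<Omega>' \<times> UNIV \<subseteq> E'"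
  using full_fibre by (auto simp: \<Omega>'_def)

lemma base_map_inverse: "x \<in> \<Omega> \<Longrightarrow> base_map k (base_map h x) = x"
proof -
  assume x: "x \<in> \<Omega>"
  then have "(x, 0) \<in> E" using cylinder by blast
  then have "fst (k (h (x, 0))) = x" using k_h by simp
  moreover have "fst (k (base_map h x, snd (h (x, 0)))) = fst (k (base_map h x, 0))"
    by (intro fst_k full_fibre x)
  ultimately show ?thesis using h_eq[OF x, of 0] by (simp add: base_map_def)
qed

lemma base_map_k_in: "y \<in> \<Omega>' \<Longrightarrow> base_map k y \<in> \<Omega>"
  by (auto simp: \<Omega>'_def base_map_inverse)

lemma base_map_h_k: "y \<in> \<Omega>' \<Longrightarrow> base_map h (base_map k y) = y"
  by (auto simp: \<Omega>'_def base_map_inverse)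

lemma inv_into_base_map: "y \<in> \<Omega>' \<Longrightarrow> inv_into \<Omega> (base_map h) y = base_map k y"
  by (auto simp: \<Omega>'_def base_map_inverse intro!: inv_into_f_eq inj_on_inverseI[where g = "base_map k"])

lemma open_\<Omega>': "open \<Omega>'"
proof -
  define P where "P = (\<lambda>y. (y, 0::real^'q)) -` E'"
  have P: "open P" unfolding P_def using open_E' by (intro open_vimage continuous_intros)
  have "continuous_on P (\<lambda>y. k (y, 0))"
    by (rule continuous_on_compose2[OF smooth_on_continuous[OF smooth_k]])
      (auto simp: P_def intro!: continuous_intros)
  then have "continuous_on P (base_map k)"
    unfolding base_map_def by (rule continuous_on_fst)
  then have "open (P \<inter> base_map k -` \<Omega>)"
    using P open_\<Omega> by (rule continuous_open_preimage)
  moreover have "P \<inter> base_map k -` \<Omega> = \<Omega>'"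
  proof (intro equalityI subsetI)
    fix y assume "y \<in> P \<inter> base_map k -` \<Omega>"
    then have y: "(y, 0) \<in> E'" "base_map k y \<in> \<Omega>" by (auto simp: P_def)
    have "k (y, 0) = (base_map k y, snd (k (y, 0)))" by (simp add: base_map_def)
    then have "y = fst (h (base_map k y, snd (k (y, 0))))" using h_k[OF y(1)] by simp
    then have "y = base_map h (base_map k y)" using fst_h[OF y(2)] by simp
    then show "y \<in> \<Omega>'" using y(2) unfolding \<Omega>'_def by blast
  next
    fix y assume "y \<in> \<Omega>'"
    then show "y \<in> P \<inter> base_map k -` \<Omega>"
      using image_cylinder base_map_k_in by (auto simp: P_def)
  qed
  ultimately show ?thesis by simp
qed

lemma smooth_base_map_k: "smooth_on \<Omega>' (base_map k)"
proof -
  have "smooth_on \<Omega>' (\<lambda>y. (y, 0::real^'q))"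
    by (intro smooth_on_Pair smooth_on_ident smooth_on_const open_\<Omega>')
  moreover have "(\<lambda>y. (y, 0::real^'q)) ` \<Omega>' \<subseteq> E'" using image_cylinder by auto
  ultimately have "smooth_on \<Omega>' (\<lambda>y. k (y, 0))"
    by (rule smooth_on_compose[OF open_\<Omega>' open_E' smooth_k])
  then show ?thesis
    unfolding base_map_def by (rule smooth_on_linear[OF open_\<Omega>' bounded_linear_fst])
qed

lemma tempered_snd_h: "fibrewise_tempered \<Omega> (\<lambda>z. snd (h z))"
  unfolding fibrewise_tempered_def
proof (intro conjI allI impI)
  show "smooth_on (\<Omega> \<times> UNIV) (\<lambda>z. snd (h z))"
    using smooth_on_subset[OF smooth_on_linear[OF open_E bounded_linear_snd smooth_h] cylinder] .
  fix K :: "(real^'p) set" and vs :: "((real^'p) \<times> (real^'q)) list"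
  assume K: "compact K" "K \<subseteq> \<Omega>" and vs: "set vs \<subseteq> Basis"
  have KE: "(x, u) \<in> E" if "x \<in> K" for x u using that K cylinder by blast
  then have "K \<subseteq> fst ` E" by force
  then obtain C m where C: "\<forall>(x, u)\<in>E. x \<in> K \<longrightarrow>
      norm (partials vs (\<lambda>z. snd (h z)) (x, u)) \<le> C * (1 + norm u) ^ m"
    using h_tempered[unfolded slowly_increasing_transformation_def, THEN conjunct2, rule_format,
        OF K(1) _ vs] by blast
  then have "\<forall>x\<in>K. \<forall>u. norm (partials vs (\<lambda>z. snd (h z)) (x, u)) \<le> C * (1 + norm u) ^ m"
    using KE by blast
  then show "\<exists>C m. \<forall>x\<in>K. \<forall>u. norm (partials vs (\<lambda>z. snd (h z)) (x, u)) \<le> C * (1 + norm u) ^ m"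
    by blast
qed

lemma act_eq: "y \<in> \<Omega>' \<Longrightarrow> act h \<Omega> u y = snd (h (base_map k y, u (base_map k y)))"
  by (simp add: act_def inv_into_base_map)

text \<open>The transform is a composition with the fibre component of \<open>h\<close>, followed by a composition with
  the inverse of the base map.\<close>

lemma moderate_act:
  assumes "u \<in> moderate \<Omega>"
  shows "(\<lambda>\<epsilon>. act h \<Omega> (u \<epsilon>)) \<in> moderate \<Omega>'"
proof (rule moderate_cong[OF open_\<Omega>'])
  show "(\<lambda>\<epsilon> y. snd (h (base_map k y, u \<epsilon> (base_map k y)))) \<in> moderate \<Omega>'"
    using moderate_compose_smooth[OF open_\<Omega>' open_\<Omega>
        moderate_tempered_compose[OF open_\<Omega> tempered_snd_h assms] smooth_base_map_k]
      base_map_k_in by blast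
qed (simp add: act_eq)

lemma smooth_act:
  assumes "smooth_on \<Omega> u"
  shows "smooth_on \<Omega>' (act h \<Omega> u)"
  using moderate_act[of "\<lambda>\<epsilon>. u"] assms by (simp add: moderate_const_net_iff)

lemma locally_negligible_act_diff:
  assumes "u \<in> moderate \<Omega>"
    and "w \<in> moderate \<Omega>"
    and "locally_negligible \<Omega> (\<lambda>\<epsilon> x. u \<epsilon> x - w \<epsilon> x)"
  shows "locally_negligible \<Omega>' (\<lambda>\<epsilon> y. act h \<Omega> (u \<epsilon>) y - act h \<Omega> (w \<epsilon>) y)"
proof -
  have "locally_negligible \<Omega> (\<lambda>\<epsilon> x. snd (h (x, u \<epsilon> x)) - snd (h (x, w \<epsilon> x)))"
    by (rule locally_negligible_tempered_diff[OF tempered_snd_h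
          moderate_locally_moderate[OF assms(1)] moderate_locally_moderate[OF assms(2)] assms(3)])
  then have "locally_negligible \<Omega>' (\<lambda>\<epsilon> y. snd (h (base_map k y, u \<epsilon> (base_map k y)))
       - snd (h (base_map k y, w \<epsilon> (base_map k y))))"
    by (rule locally_negligible_compose_continuous[OF _ smooth_on_continuous[OF smooth_base_map_k]])
      (use base_map_k_in in blast)
  then show ?thesis
    by (rule locally_negligible_dominated) (simp add: act_eq)
qed

lemma transforms_to_act: "transforms_to E h \<Omega> u \<Omega>' (act h \<Omega> u)"
proof -
  have "h (x, u x) = (base_map h x, act h \<Omega> u (base_map h x))" if "x \<in> \<Omega>" for x
    using h_eq[OF that] act_eq[of "base_map h x"] that by (simp add: \<Omega>'_def base_map_inverse)
  then have "h ` graph_on \<Omega> u = graph_on \<Omega>' (act h \<Omega> u)"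
    by (auto simp: graph_on_def \<Omega>'_def image_image)
  moreover have "graph_on \<Omega> u \<subseteq> E" using cylinder by (auto simp: graph_on_def)
  ultimately show ?thesis using open_\<Omega> open_\<Omega>' by (simp add: transforms_to_def)
qed

lemma prolongs_to_act:
  assumes "smooth_on \<Omega> u" "x \<in> \<Omega>"
  shows "prolongs_to E h (jet u x) (jet (act h \<Omega> u) (base_map h x))"
  unfolding prolongs_to_def
  using transforms_to_act[of u] assms smooth_act fst_h[OF assms(2), of "u x"] by metis

end

section \<open>Classes of nets\<close>

lemma net_rel_iff:
  assumes "open \<Omega>"
  shows "(u, v) \<in> net_rel \<Omega> \<longleftrightarrow> u \<in> moderate \<Omega> \<and> v \<in> moderate \<Omega> \<and>
     locally_negligible \<Omega> (\<lambda>\<epsilon> x. u \<epsilon> x - v \<epsilon> x)"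
  using negligible_iff_locally_negligible[OF assms moderate_diff[OF assms]]
  unfolding net_rel_def by blast

text \<open>Transitivity of the relation comes down to the values of the nets, by the characterization
  of negligible nets.\<close>

lemma cl_eq_iff:
  assumes "open \<Omega>" "v \<in> moderate \<Omega>"
  shows "cl \<Omega> u = cl \<Omega> v \<longleftrightarrow> (u, v) \<in> net_rel \<Omega>"
proof
  assume "cl \<Omega> u = cl \<Omega> v"
  moreover have "(v, v) \<in> net_rel \<Omega>"
    using assms by (simp add: net_rel_iff locally_negligible_def negligible_bound_def exI[of _ 0])
  then have "v \<in> cl \<Omega> v" by (simp add: cl_def)
  ultimately show "(u, v) \<in> net_rel \<Omega>" by (auto simp: cl_def)
next
  assume uv: "(u, v) \<in> net_rel \<Omega>"
  have "(u, w) \<in> net_rel \<Omega> \<longleftrightarrow> (v, w) \<in> net_rel \<Omega>" for w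
    using uv locally_negligible_diff_trans[of \<Omega> u v w]
      locally_negligible_diff_trans[of \<Omega> v u w] locally_negligible_swap[of \<Omega> u v]
    unfolding net_rel_iff[OF assms(1)] by blast
  then show "cl \<Omega> u = cl \<Omega> v" by (auto simp: cl_def)
qed

lemma rep_cl:
  assumes "open \<Omega>" "u \<in> moderate \<Omega>"
  shows "(u, rep (cl \<Omega> u)) \<in> net_rel \<Omega>"
proof -
  have "u \<in> cl \<Omega> u"
    using cl_eq_iff[OF assms, of u] by (simp add: cl_def)
  then have "rep (cl \<Omega> u) \<in> cl \<Omega> u"
    unfolding rep_def by (rule someI[where P = "\<lambda>v. v \<in> cl \<Omega> u"])
  then show ?thesis by (simp add: cl_def)
qed

lemma cl_in_colombeau: "u \<in> moderate \<Omega> \<Longrightarrow> cl \<Omega> u \<in> colombeau \<Omega>"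
  unfolding cl_def colombeau_def by (rule quotientI)

lemma rep_moderate:
  assumes "open \<Omega>" "U \<in> colombeau \<Omega>"
  shows "rep U \<in> moderate \<Omega>"
proof -
  obtain u where "u \<in> moderate \<Omega>" "U = cl \<Omega> u"
    using assms(2) by (auto simp: colombeau_def cl_def elim: quotientE)
  then show ?thesis using rep_cl[OF assms(1)] by (auto simp: net_rel_iff[OF assms(1)])
qed

section \<open>The left-hand side of the equation\<close>

text \<open>A power of \<open>1 + norm (x, u)\<close> is, for \<open>x\<close> in a bounded set, at most a constant times the same
  power of \<open>1 + norm u\<close>.\<close>

lemma tempered_equation:
  fixes \<Delta> :: "('p::finite, 'q::finite, 'n::len0) jet \<Rightarrow> real"
  assumes "slowly_increasing_on (jet_space M) \<Delta>" "\<Omega> \<times> UNIV \<subseteq> M"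
  shows "fibrewise_tempered \<Omega> \<Delta>"
  unfolding fibrewise_tempered_def
proof (intro conjI allI impI)
  have sub: "\<Omega> \<times> UNIV \<subseteq> jet_space M" using assms(2) by (auto simp: jet_space_def)
  show "smooth_on (\<Omega> \<times> UNIV) \<Delta>"
    using assms(1) sub smooth_on_subset unfolding slowly_increasing_on_def by blast
  fix K and vs :: "('p, 'q, 'n) jet list"
  assume K: "compact K" "K \<subseteq> \<Omega>" and vs: "set vs \<subseteq> Basis"
  obtain C m where C: "\<And>z. z \<in> jet_space M \<Longrightarrow> norm (partials vs \<Delta> z) \<le> C * (1 + norm z) ^ m"
    using assms(1) vs unfolding slowly_increasing_on_def by metis
  obtain R where R: "R \<ge> 0" "\<And>x. x \<in> K \<Longrightarrow> norm x \<le> R"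
    using compact_imp_bounded[OF K(1)] unfolding bounded_pos by (meson less_imp_le)
  have "norm (partials vs \<Delta> (x, u)) \<le> (\<bar>C\<bar> * (1 + R) ^ m) * (1 + norm u) ^ m" if x: "x \<in> K" for x u
  proof -
    have "norm (x, u) \<le> norm x + norm u" by (rule norm_Pair_le)
    also have "\<dots> \<le> R + norm u + R * norm u"
      using R(2)[OF x] mult_nonneg_nonneg[OF R(1) norm_ge_zero[of u]] by linarith
    finally have "1 + norm (x, u) \<le> (1 + R) * (1 + norm u)" by (simp add: algebra_simps)
    then have "(1 + norm (x, u)) ^ m \<le> ((1 + R) * (1 + norm u)) ^ m"
      by (intro power_mono) auto
    then have "C * (1 + norm (x, u)) ^ m \<le> \<bar>C\<bar> * ((1 + R) * (1 + norm u)) ^ m"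
      by (intro mult_mono) auto
    moreover have "norm (partials vs \<Delta> (x, u)) \<le> C * (1 + norm (x, u)) ^ m"
      using x K sub by (intro C) auto
    ultimately show ?thesis by (simp add: power_mult_distrib mult.assoc)
  qed
  then show "\<exists>C m. \<forall>x\<in>K. \<forall>u. norm (partials vs \<Delta> (x, u)) \<le> C * (1 + norm u) ^ m" by blast
qed

lemma moderate_equation:
  fixes \<Delta> :: "('p::finite, 'q::finite, 'n::len0) jet \<Rightarrow> real"
  assumes "open \<Omega>" "fibrewise_tempered \<Omega> \<Delta>" "u \<in> moderate \<Omega>"
  shows "(\<lambda>\<epsilon> x. \<Delta> (jet (u \<epsilon>) x)) \<in> moderate \<Omega>"
  unfolding jet_def using moderate_tempered_compose[OF assms(1,2) moderate_jet_part[OF assms(1,3)]] .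

lemma locally_negligible_equation_diff:
  fixes \<Delta> :: "('p::finite, 'q::finite, 'n::len0) jet \<Rightarrow> real"
  assumes "open \<Omega>" "fibrewise_tempered \<Omega> \<Delta>" "u \<in> moderate \<Omega>" "w \<in> moderate \<Omega>"
    and "locally_negligible \<Omega> (\<lambda>\<epsilon> x. u \<epsilon> x - w \<epsilon> x)"
  shows "locally_negligible \<Omega> (\<lambda>\<epsilon> x. \<Delta> (jet (u \<epsilon>) x) - \<Delta> (jet (w \<epsilon>) x))"
  unfolding jet_def
  by (rule locally_negligible_tempered_diff[OF assms(2)
        moderate_locally_moderate[OF moderate_jet_part[OF assms(1,3)]]
        moderate_locally_moderate[OF moderate_jet_part[OF assms(1,4)]]
        locally_negligible_jet_part_diff[OF assms(1,3-5)]])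

lemma eval_in_colombeau_eq_zero_iff:
  fixes \<Delta> :: "('p::finite, 'q::finite, 'n::len0) jet \<Rightarrow> real"
  assumes "open \<Omega>" "fibrewise_tempered \<Omega> \<Delta>" "rep U \<in> moderate \<Omega>"
  shows "eval_in_colombeau \<Delta> \<Omega> U = cl \<Omega> (\<lambda>\<epsilon> x. 0) \<longleftrightarrow>
    locally_negligible \<Omega> (\<lambda>\<epsilon> x. \<Delta> (jet (rep U \<epsilon>) x))"
proof -
  have "(\<lambda>\<epsilon> x. 0 :: real) \<in> moderate \<Omega>"
    by (rule moderate_const[OF assms(1) moderate_bound_const])
  then show ?thesis
    unfolding eval_in_colombeau_def
    using cl_eq_iff[OF assms(1), of "\<lambda>\<epsilon> x. 0" "\<lambda>\<epsilon> x. \<Delta> (jet (rep U \<epsilon>) x)"]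
      moderate_equation[OF assms]
    by (simp add: net_rel_iff[OF assms(1)])
qed

lemma affine_along_line:
  fixes F :: "'a::real_normed_vector \<Rightarrow> real"
  assumes "\<And>t. F differentiable (at (z + t *\<^sub>R e))"
    and "\<And>t. frechet_derivative F (at (z + t *\<^sub>R e)) e = c"
  shows "F (z + t *\<^sub>R e) = F z + c * t"
proof -
  have "((\<lambda>t. F (z + t *\<^sub>R e) - c * t) has_real_derivative 0) (at t)" for t
  proof -
    have "((\<lambda>t. z + t *\<^sub>R e) has_derivative (\<lambda>s. s *\<^sub>R e)) (at t)"
      by (auto intro!: derivative_eq_intros)
    from has_derivative_compose[OF this assms(1)[of t, unfolded frechet_derivative_works]]
    have "((\<lambda>t. F (z + t *\<^sub>R e)) has_derivative (\<lambda>s. c * s)) (at t)"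
      using linear_frechet_derivative[OF assms(1)[of t]] assms(2)[of t]
      by (simp add: linear_scale mult.commute)
    then have "((\<lambda>t. F (z + t *\<^sub>R e)) has_real_derivative c) (at t)"
      by (simp add: has_field_derivative_def)
    then show ?thesis by (auto intro!: derivative_eq_intros)
  qed
  then have "F (z + t *\<^sub>R e) - c * t = F (z + 0 *\<^sub>R e) - c * 0"
    using DERIV_isconst_all[of "\<lambda>t. F (z + t *\<^sub>R e) - c * t"] by blast
  then show ?thesis by simp
qed

text \<open>Adding a multiple of this function moves the jet at \<open>x0\<close> along the coordinate \<open>u\<^sub>\<alpha>\<^sup>a\<close> only.\<close>

definition jet_correction ::
    "('p::finite, 'n::len0) multi_index \<Rightarrow> 'q::finite \<Rightarrow> real^'p \<Rightarrow> real^'p \<Rightarrow> real^'q" where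
  "jet_correction \<alpha> a x0 y = divided_power (Rep_multi_index \<alpha>) (y - x0) *\<^sub>R axis a 1"

lemma smooth_on_jet_correction:
  assumes "open \<Omega>"
  shows "smooth_on \<Omega> (jet_correction \<alpha> a x0)"
proof -
  have "(\<lambda>\<epsilon> y. divided_power (Rep_multi_index \<alpha>) (y - x0)) \<in> moderate \<Omega>"
    by (rule moderate_divided_power[OF assms moderate_bound_const])
  from moderate_linear[OF assms bounded_linear_scaleR_left this, of "axis a 1"]
  show ?thesis unfolding jet_correction_def moderate_const_net_iff[symmetric] .
qed

lemma jet_add_correction:
  fixes \<alpha> :: "('p::finite, 'n::len0) multi_index" and a :: "'q::finite"
  assumes "open \<Omega>" "smooth_on \<Omega> u" "x0 \<in> \<Omega>"
  shows "jet (\<lambda>y. u y + t *\<^sub>R jet_correction \<alpha> a x0 y) x0 = jet u x0 + t *\<^sub>R jet_unit \<alpha> a"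
proof -
  have "(jet_part (jet_correction \<alpha> a x0) x0 :: (real^'q)^(('p, 'n) multi_index)) = axis \<alpha> (axis a 1)"
    unfolding jet_correction_def[abs_def] by (rule jet_part_divided_power)
  then show ?thesis
    unfolding jet_def jet_unit_def
      jet_part_add_scaleR[OF assms(1,2) smooth_on_jet_correction[OF assms(1)] assms(3)]
    by simp
qed

lemma corrected_jet_solves:
  fixes \<Delta> :: "('p::finite, 'q::finite, 'n::len0) jet \<Rightarrow> real"
  assumes "open \<Omega>"
    and "smooth_on (\<Omega> \<times> UNIV) \<Delta>"
    and "smooth_on \<Omega> u"
    and "x0 \<in> \<Omega>"
    and "c \<noteq> 0"
    and "\<And>z. z \<in> \<Omega> \<times> UNIV \<Longrightarrow> frechet_derivative \<Delta> (at z) (jet_unit \<alpha> a) = c"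
  shows "\<Delta> (jet (\<lambda>y. u y + (- \<Delta> (jet u x0) / c) *\<^sub>R jet_correction \<alpha> a x0 y) x0) = 0"
proof -
  have in_cyl: "jet u x0 + t *\<^sub>R jet_unit \<alpha> a \<in> \<Omega> \<times> UNIV" for t
    using assms(4) by (simp add: jet_def jet_unit_def)
  have "\<Delta> (jet u x0 + (- \<Delta> (jet u x0) / c) *\<^sub>R jet_unit \<alpha> a)
      = \<Delta> (jet u x0) + c * (- \<Delta> (jet u x0) / c)"
    by (rule affine_along_line) (use in_cyl assms(2,6) smooth_on_differentiable in blast)+
  then show ?thesis
    unfolding jet_add_correction[OF assms(1,3,4)] using assms(5) by simp
qed

text \<open>The base points \<open>x0 \<epsilon>\<close> stay in a bounded set, so the monomials centred at them form a moderate
  net, and the factors \<open>s \<epsilon>\<close> decay faster than any power.\<close>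

lemma negligible_correction:
  fixes \<alpha> :: "('p::finite, 'n::len0) multi_index" and a :: "'q::finite"
  assumes "open \<Omega>" "bounded X" "\<And>\<epsilon>. \<epsilon> \<in> {0<..1} \<Longrightarrow> x0 \<epsilon> \<in> X"
    and "negligible_bound UNIV (\<lambda>\<epsilon> y::real^'p. s \<epsilon>)"
  shows "(\<lambda>\<epsilon> y. s \<epsilon> *\<^sub>R jet_correction \<alpha> a (x0 \<epsilon>) y) \<in> moderate \<Omega>"
    and "locally_negligible \<Omega> (\<lambda>\<epsilon> y. s \<epsilon> *\<^sub>R jet_correction \<alpha> a (x0 \<epsilon>) y)"
proof -
  obtain R where "\<And>x. x \<in> X \<Longrightarrow> norm x \<le> R" using assms(2) unfolding bounded_iff by blast
  then have "moderate_bound UNIV (\<lambda>\<epsilon> y::real^'p. x0 \<epsilon>)"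
    using assms(3) by (intro moderate_bound_bounded[of _ _ R]) blast
  then have "(\<lambda>\<epsilon> y. divided_power (Rep_multi_index \<alpha>) (y - x0 \<epsilon>)) \<in> moderate \<Omega>"
    by (rule moderate_divided_power[OF assms(1)])
  from moderate_linear[OF assms(1) bounded_linear_scaleR_left this, of "axis a 1"]
  have J: "(\<lambda>\<epsilon> y. jet_correction \<alpha> a (x0 \<epsilon>) y) \<in> moderate \<Omega>"
    unfolding jet_correction_def .
  have s: "moderate_bound UNIV (\<lambda>\<epsilon> y::real^'p. s \<epsilon>)"
    using assms(4) by (rule negligible_imp_moderate_bound)
  show "(\<lambda>\<epsilon> y. s \<epsilon> *\<^sub>R jet_correction \<alpha> a (x0 \<epsilon>) y) \<in> moderate \<Omega>"
    by (rule moderate_bilinear[OF assms(1) bounded_bilinear_scaleR moderate_const[OF assms(1) s] J])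
  show "locally_negligible \<Omega> (\<lambda>\<epsilon> y. s \<epsilon> *\<^sub>R jet_correction \<alpha> a (x0 \<epsilon>) y)"
    unfolding locally_negligible_def
  proof (intro allI impI)
    fix K assume K: "compact K" "K \<subseteq> \<Omega>"
    have "moderate_bound K (\<lambda>\<epsilon> y. jet_correction \<alpha> a (x0 \<epsilon>) y)"
      using moderate_locally_moderate[OF J] K unfolding locally_moderate_def by blast
    then have 1: "moderate_bound K (\<lambda>\<epsilon> y. norm (jet_correction \<alpha> a (x0 \<epsilon>) y))"
      by (simp add: moderate_bound_norm_iff)
    have 2: "negligible_bound K (\<lambda>\<epsilon> y. s \<epsilon>)"
      by (rule negligible_bound_subset[OF assms(4) subset_UNIV])
    show "negligible_bound K (\<lambda>\<epsilon> y. s \<epsilon> *\<^sub>R jet_correction \<alpha> a (x0 \<epsilon>) y)"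
      by (rule negligible_bound_dominated[OF negligible_bound_mult[OF 1 2]]) (simp add: abs_mult)
  qed
qed

section \<open>Transport of solutions\<close>

context slowly_increasing_diffeo
begin

text \<open>The residual of the transformed net is compared, at a point where it is largest, with that of the
  transform of a corrected net which solves the equation exactly at that point.\<close>

lemma negligible_equation_act:
  fixes \<Delta> :: "('p, 'q, 'n::len0) jet \<Rightarrow> real"
  assumes tempered: "fibrewise_tempered \<Omega> \<Delta>" "fibrewise_tempered \<Omega>' \<Delta>"
    and c: "c \<noteq> 0" "\<And>z. z \<in> \<Omega> \<times> UNIV \<Longrightarrow> frechet_derivative \<Delta> (at z) (jet_unit \<alpha> a) = c"
    and symmetry: "\<And>z w. z \<in> \<Omega> \<times> UNIV \<Longrightarrow> \<Delta> z = 0 \<Longrightarrow> prolongs_to E h z w \<Longrightarrow> \<Delta> w = 0"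
    and u: "u \<in> moderate \<Omega>" "locally_negligible \<Omega> (\<lambda>\<epsilon> x. \<Delta> (jet (u \<epsilon>) x))"
  shows "locally_negligible \<Omega>' (\<lambda>\<epsilon> y. \<Delta> (jet (act h \<Omega> (u \<epsilon>)) y))"
  unfolding locally_negligible_def
proof (intro allI impI)
  fix K assume K: "compact K" "K \<subseteq> \<Omega>'"
  let ?v = "\<lambda>\<epsilon>. act h \<Omega> (u \<epsilon>)"
  show "negligible_bound K (\<lambda>\<epsilon> y. \<Delta> (jet (?v \<epsilon>) y))"
  proof (cases "K = {}")
    case True
    then show ?thesis by (simp add: negligible_bound_def)
  next
    case False
    have v: "(\<lambda>\<epsilon> y. \<Delta> (jet (?v \<epsilon>) y)) \<in> moderate \<Omega>'"
      by (rule moderate_equation[OF open_\<Omega>' tempered(2) moderate_act[OF u(1)]])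
    have "\<exists>y\<in>K. \<forall>y'\<in>K. \<bar>\<Delta> (jet (?v \<epsilon>) y')\<bar> \<le> \<bar>\<Delta> (jet (?v \<epsilon>) y)\<bar>" if "\<epsilon> \<in> {0<..1}" for \<epsilon>
    proof (rule continuous_attains_sup[OF K(1) False])
      show "continuous_on K (\<lambda>y. \<bar>\<Delta> (jet (?v \<epsilon>) y)\<bar>)"
        using continuous_on_subset[OF smooth_on_continuous[OF moderate_smooth[OF v that]] K(2)]
        by (rule continuous_on_rabs)
    qed
    then obtain p where p: "\<And>\<epsilon>. \<epsilon> \<in> {0<..1} \<Longrightarrow> p \<epsilon> \<in> K"
      and p_max: "\<And>\<epsilon> y. \<epsilon> \<in> {0<..1} \<Longrightarrow> y \<in> K \<Longrightarrow> \<bar>\<Delta> (jet (?v \<epsilon>) y)\<bar> \<le> \<bar>\<Delta> (jet (?v \<epsilon>) (p \<epsilon>))\<bar>"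
      by metis
    \<comment> \<open>the factor \<open>s \<epsilon>\<close> cancels the residual of \<open>u \<epsilon>\<close> at the preimage \<open>x0 \<epsilon>\<close> of the worst point\<close>
    define x0 where "x0 \<epsilon> = base_map k (p \<epsilon>)" for \<epsilon>
    define s where "s \<epsilon> = - \<Delta> (jet (u \<epsilon>) (x0 \<epsilon>)) / c" for \<epsilon>
    define w where "w \<epsilon> y = u \<epsilon> y + s \<epsilon> *\<^sub>R jet_correction \<alpha> a (x0 \<epsilon>) y" for \<epsilon> y
    let ?X = "base_map k ` K"
    have X: "compact ?X" "?X \<subseteq> \<Omega>"
      using K base_map_k_in continuous_on_subset[OF smooth_on_continuous[OF smooth_base_map_k]]
      by (auto intro: compact_continuous_image)
    have x0: "x0 \<epsilon> \<in> ?X" if "\<epsilon> \<in> {0<..1}" for \<epsilon>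
      using p[OF that] by (simp add: x0_def)
    have "negligible_bound ?X (\<lambda>\<epsilon> x. \<Delta> (jet (u \<epsilon>) x))"
      using u(2) X unfolding locally_negligible_def by blast
    from negligible_bound_at_points[OF this x0]
    have N: "negligible_bound UNIV (\<lambda>\<epsilon> y::real^'p. \<Delta> (jet (u \<epsilon>) (x0 \<epsilon>)))" .
    have s: "negligible_bound UNIV (\<lambda>\<epsilon> y::real^'p. s \<epsilon>)"
      using negligible_bound_mult[OF moderate_bound_const[of _ "- inverse c"] N]
      by (simp add: s_def field_simps)
    have wu: "locally_negligible \<Omega> (\<lambda>\<epsilon> y. w \<epsilon> y - u \<epsilon> y)"
      using negligible_correction(2)[OF open_\<Omega> compact_imp_bounded[OF X(1)] x0 s, where \<alpha> = \<alpha> and a = a] by (simp add: w_def)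
    have w: "w \<in> moderate \<Omega>"
      using moderate_add[OF open_\<Omega> u(1)
          negligible_correction(1)[OF open_\<Omega> compact_imp_bounded[OF X(1)] x0 s, where \<alpha> = \<alpha> and a = a]]
      unfolding w_def .
    have solves: "\<Delta> (jet (act h \<Omega> (w \<epsilon>)) (p \<epsilon>)) = 0" if \<epsilon>: "\<epsilon> \<in> {0<..1}" for \<epsilon>
    proof (rule symmetry)
      have x: "x0 \<epsilon> \<in> \<Omega>" using x0[OF \<epsilon>] X by blast
      show "jet (w \<epsilon>) (x0 \<epsilon>) \<in> \<Omega> \<times> UNIV" using x by (simp add: jet_def)
      show "\<Delta> (jet (w \<epsilon>) (x0 \<epsilon>)) = 0"
        unfolding w_def[abs_def] s_def
        by (rule corrected_jet_solves[OF open_\<Omega> tempered(1)[unfolded fibrewise_tempered_def, THEN conjunct1]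
              moderate_smooth[OF u(1) \<epsilon>] x c])
      have "base_map h (x0 \<epsilon>) = p \<epsilon>"
        using p[OF \<epsilon>] K(2) base_map_h_k unfolding x0_def by blast
      then show "prolongs_to E h (jet (w \<epsilon>) (x0 \<epsilon>)) (jet (act h \<Omega> (w \<epsilon>)) (p \<epsilon>))"
        using prolongs_to_act[OF moderate_smooth[OF w \<epsilon>] x] by metis
    qed
    have "locally_negligible \<Omega>' (\<lambda>\<epsilon> y. \<Delta> (jet (act h \<Omega> (w \<epsilon>)) y) - \<Delta> (jet (?v \<epsilon>) y))"
      by (rule locally_negligible_equation_diff[OF open_\<Omega>' tempered(2) moderate_act[OF w]
            moderate_act[OF u(1)] locally_negligible_act_diff[OF w u(1) wu]])
    then have "negligible_bound K (\<lambda>\<epsilon> y. \<Delta> (jet (act h \<Omega> (w \<epsilon>)) y) - \<Delta> (jet (?v \<epsilon>) y))"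
      using K unfolding locally_negligible_def by blast
    from negligible_bound_at_points[OF this p]
    show ?thesis
    proof (rule negligible_bound_dominated)
      fix \<epsilon> :: real and y assume "\<epsilon> \<in> {0<..1}" "y \<in> K"
      then show "norm (\<Delta> (jet (?v \<epsilon>) y))
          \<le> norm (\<Delta> (jet (act h \<Omega> (w \<epsilon>)) (p \<epsilon>)) - \<Delta> (jet (?v \<epsilon>) (p \<epsilon>)))"
        using p_max[of \<epsilon> y] solves[of \<epsilon>] unfolding real_norm_def by linarith
    qed
  qed
qed

end

lemma local_transformation_group_inverse:
  assumes G: "local_transformation_group M D g" and m: "m \<in> at_param D \<eta>"
  shows "g \<eta> m \<in> at_param D (- \<eta>)" "g (- \<eta>) (g \<eta> m) = m"
proof -
  have D: "(\<eta>, m) \<in> D" using m by (simp add: at_param_def)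
  then have "m \<in> M" using G by (auto simp: local_transformation_group_def)
  then have 0: "(0, m) \<in> D" "g 0 m = m" using G by (auto simp: local_transformation_group_def)
  have 1: "(- \<eta>, g \<eta> m) \<in> D" using G D by (auto simp: local_transformation_group_def)
  then show "g \<eta> m \<in> at_param D (- \<eta>)" by (simp add: at_param_def)
  have "\<forall>\<eta> \<delta> m. (\<delta>, m) \<in> D \<longrightarrow> (\<eta>, g \<delta> m) \<in> D \<longrightarrow> (\<eta> + \<delta>, m) \<in> D \<longrightarrow>
        g \<eta> (g \<delta> m) = g (\<eta> + \<delta>) m"
    using G by (simp add: local_transformation_group_def)
  then have "g (- \<eta>) (g \<eta> m) = g (- \<eta> + \<eta>) m"
    using D 1 0 by (metis add.left_inverse)
  then show "g (- \<eta>) (g \<eta> m) = m" using 0 by simp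
qed

lemma local_transformation_group_slice:
  fixes M :: "'a::euclidean_space set"
  assumes G: "local_transformation_group M D g"
  shows "open (at_param D \<eta>)" "at_param D \<eta> \<subseteq> M" "smooth_on (at_param D \<eta>) (g \<eta>)"
proof -
  have D: "open D" "D \<subseteq> UNIV \<times> M" "smooth_on D (\<lambda>(\<eta>, m). g \<eta> m)"
    using G by (auto simp: local_transformation_group_def)
  have eq: "at_param D \<eta> = Pair \<eta> -` D" by (auto simp: at_param_def)
  show op: "open (at_param D \<eta>)"
    unfolding eq using D(1) by (intro open_vimage continuous_intros)
  show "at_param D \<eta> \<subseteq> M" using D(2) by (auto simp: at_param_def)
  have "smooth_on (at_param D \<eta>) (\<lambda>m. case (\<eta>, m) of (\<eta>, m) \<Rightarrow> g \<eta> m)"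
    by (rule smooth_on_compose[OF op D(1,3) smooth_on_Pair[OF op smooth_on_const[OF op] smooth_on_ident[OF op]]])
      (auto simp: at_param_def)
  then show "smooth_on (at_param D \<eta>) (g \<eta>)" by simp
qed

theorem theorem3p8:
  fixes M :: "((real^'p) \<times> (real^'q)) set"
    and D :: "(real \<times> ((real^'p) \<times> (real^'q))) set"
    and g :: "real \<Rightarrow> (real^'p) \<times> (real^'q) \<Rightarrow> (real^'p) \<times> (real^'q)"
    and \<Delta> :: "('p::finite, 'q::finite, 'n::len0) jet \<Rightarrow> real"
    and \<alpha> :: "('p, 'n) multi_index" and a :: 'q and c :: real
  assumes "local_transformation_group M D g"
    and "slowly_increasing_group D g"
    and "slowly_increasing_on (jet_space M) \<Delta>"
    and "symmetry_group M D g \<Delta>"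
    and "\<forall>z\<in>jet_space M. frechet_derivative \<Delta> (at z) (jet_unit \<alpha> a) = c"
    and "c \<noteq> 0"
  shows "colombeau_symmetry_group M D g \<Delta>"
  unfolding colombeau_symmetry_group_def
proof (intro allI impI)
  fix \<eta> \<Omega> and U :: "(real^'p, real^'q) net set"
  assume sol: "colombeau_solution M \<Delta> \<Omega> U" and cyl: "\<Omega> \<times> UNIV \<subseteq> at_param D \<eta>"
  have \<Omega>: "open \<Omega>" "\<Omega> \<times> UNIV \<subseteq> M" "U \<in> colombeau \<Omega>" "eval_in_colombeau \<Delta> \<Omega> U = cl \<Omega> (\<lambda>\<epsilon> x. 0)"
    using sol by (auto simp: colombeau_solution_def)
  note inv = local_transformation_group_inverse[OF assms(1)]
  note slice = local_transformation_group_slice[OF assms(1)]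
  interpret slowly_increasing_diffeo "at_param D \<eta>" "at_param D (- \<eta>)" "g \<eta>" "g (- \<eta>)" \<Omega>
  proof
    show "slowly_increasing_transformation (at_param D \<eta>) (g \<eta>)"
      "slowly_increasing_transformation (at_param D (- \<eta>)) (g (- \<eta>))"
      using assms(2) by (simp_all add: slowly_increasing_group_def)
  qed (use slice inv[of _ \<eta>] inv[of _ "- \<eta>"] \<Omega>(1) cyl in auto)
  have \<Omega>'M: "\<Omega>' \<times> UNIV \<subseteq> M" using image_cylinder slice(2) by blast
  have cyl_jets: "\<Omega> \<times> UNIV \<subseteq> jet_space M" using \<Omega>(2) by (auto simp: jet_space_def)
  have tempered: "fibrewise_tempered \<Omega> \<Delta>" "fibrewise_tempered \<Omega>' \<Delta>"
    using tempered_equation[OF assms(3)] \<Omega>(2) \<Omega>'M by blast+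
  define u where "u = rep U"
  define v where "v = (\<lambda>\<epsilon>. act (g \<eta>) \<Omega> (u \<epsilon>))"
  \<comment> \<open>the equation is evaluated at a chosen representative \<open>w\<close> of the transform, not at \<open>v\<close> itself\<close>
  define w where "w = rep (cl \<Omega>' v)"
  have u: "u \<in> moderate \<Omega>" unfolding u_def by (rule rep_moderate[OF \<Omega>(1,3)])
  have eq_u: "locally_negligible \<Omega> (\<lambda>\<epsilon> x. \<Delta> (jet (u \<epsilon>) x))"
    using eval_in_colombeau_eq_zero_iff[OF \<Omega>(1) tempered(1)] u \<Omega>(4) unfolding u_def by blast
  have eq_v: "locally_negligible \<Omega>' (\<lambda>\<epsilon> y. \<Delta> (jet (v \<epsilon>) y))"
    unfolding v_def
  proof (rule negligible_equation_act[OF tempered assms(6) _ _ u eq_u])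
    show "frechet_derivative \<Delta> (at z) (jet_unit \<alpha> a) = c" if "z \<in> \<Omega> \<times> UNIV" for z
      using assms(5) that cyl_jets by blast
    show "\<Delta> w = 0" if "z \<in> \<Omega> \<times> UNIV" "\<Delta> z = 0" "prolongs_to (at_param D \<eta>) (g \<eta>) z w" for z w
      using assms(4) that cyl_jets unfolding symmetry_group_def by blast
  qed
  have v: "v \<in> moderate \<Omega>'" unfolding v_def by (rule moderate_act[OF u])
  from rep_cl[OF open_\<Omega>' v] have vw: "w \<in> moderate \<Omega>'" "locally_negligible \<Omega>' (\<lambda>\<epsilon> x. v \<epsilon> x - w \<epsilon> x)"
    by (simp_all add: net_rel_iff[OF open_\<Omega>'] w_def)
  have "locally_negligible \<Omega>' (\<lambda>\<epsilon> y. \<Delta> (jet (w \<epsilon>) y) - \<Delta> (jet (v \<epsilon>) y))"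
    by (rule locally_negligible_equation_diff[OF open_\<Omega>' tempered(2) vw(1) v
          locally_negligible_swap[OF vw(2)]])
  from locally_negligible_add[OF this eq_v]
  have "locally_negligible \<Omega>' (\<lambda>\<epsilon> y. \<Delta> (jet (w \<epsilon>) y))" by simp
  then have "eval_in_colombeau \<Delta> \<Omega>' (cl \<Omega>' v) = cl \<Omega>' (\<lambda>\<epsilon> x. 0)"
    using eval_in_colombeau_eq_zero_iff[OF open_\<Omega>' tempered(2)] vw(1) unfolding w_def by blast
  then have "colombeau_solution M \<Delta> \<Omega>' (cl \<Omega>' v)"
    using open_\<Omega>' \<Omega>'M cl_in_colombeau[OF v] by (simp add: colombeau_solution_def)
  then show "colombeau_solution M \<Delta> (base_map (g \<eta>) ` \<Omega>) (colombeau_act (g \<eta>) \<Omega> U)"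
    by (simp add: colombeau_act_def \<Omega>'_def v_def u_def)
qed

end
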